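(* Let $V:\mathbb{S}^1\to\mathbb{R}$ be a $C^2$ function. For each $k$ let $\pi_{k,V}$ be the stationary probability of the continuous time Gibbs Markov chain on $\Gamma_k$ associated to $kV_k$, let $\mathbb{P}^{kV_k}_{\pi_{k,V}}$ be the law of this chain started from $\pi_{k,V}$, and let $\mathbb{P}_{\pi_{k,V}}$ be the law of the unperturbed chain with generator $kL_k$ started from $\pi_{k,V}$. Let $$H(\mathbb{P}^{kV_k}_{\pi_{k,V}}|\mathbb{P}_{\pi_{k,V}})=\lim_{T\to\infty}\frac1T\Big(-\int\log\Big(\frac{d\mathbb{P}^{kV_k}_{\pi_{k,V}}}{d\mathbb{P}_{\pi_{k,V}}}\Big|_{\mathcal{F}_T}\Big)\,d\mathbb{P}^{kV_k}_{\pi_{k,V}}\Big)$$ be the entropy of the Gibbs state. Then for every $k$, $$H(\mathbb{P}^{kV_k}_{\pi_{k,V}}|\mathbb{P}_{\pi_{k,V}})=\int kV_k\,d\pi_{k,V}-\lambda_k.$$ Moreover, if the maximum of $V$ is attained at a unique point $x_0$ (so that the Mather measure is the Dirac delta at $x_0$), then the limit entropy is zero: $$H(V)=\lim_{k\to\infty}\frac1kH(\mathbb{P}^{kV_k}_{\pi_{k,V}}|\mathbb{P}_{\pi_{k,V}})=\lim_{k\to\infty}\int V_k\,d\pi_{k,V}-\lim_{k\to\infty}\frac1k\lambda_k=V(x_0)-c(L)=0,$$ where $c(L)=\sup\{V(x)\mid x\in\mathbb{S}^1\}$.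
   Context: $\mathbb{S}^1$ is the unit circle identified with $[0,1)$, and $\Gamma_k=\{0,1/k,\dots,(k-1)/k\}$, with indices mod $k$. $L_k$ acts on $f:\Gamma_k\to\mathbb{R}$ by $(L_kf)(\frac jk)=f(\frac{j+1}k)+f(\frac{j-1}k)-2f(\frac jk)$, so $kL_k$ generates the chain jumping to each neighbour at rate $k$. $V_k$ is the restriction of $V$ to $\Gamma_k$, and $kV_k$ is also viewed as a diagonal matrix. By the continuous time Perron theorem there are a real $\lambda_k$, a unique positive function $u_k$ on $\Gamma_k$ and a unique probability vector $\mu_k$ on $\Gamma_k$ such that $\sum_ju_k(j/k)\mu_k(j/k)=1$, $(kL_k+kV_k)u_k=\lambda_ku_k$, and $\lim_{t\to\infty}e^{-t\lambda_k}e^{t(kL_k+kV_k)}v=\big(\sum_jv(j/k)\mu_k(j/k)\big)u_k$ for every $v:\Gamma_k\to\mathbb{R}$. The Gibbs Markov chain associated to $kV_k$ is the chain that jumps from $x$ to a neighbour $y$ at rate $k\,u_k(y)/u_k(x)$; its stationary probability is $\pi_{k,V}(j/k)=u_k(j/k)\mu_k(j/k)$. Laws are taken on the Skorohod space of càdlàg paths with values in $\Gamma_k$, and $\mathcal{F}_T$ is the sigma-algebra generated by the path up to time $T$. The Mather measure is the probability attaining the infimum $\inf_\mu\int L^V\,d\mu$ over invariant probabilities $\mu$ of the Euler–Lagrange flow of $L^V(x,v)=-V(x)+v\log\big((v+\sqrt{v^2+4})/2\big)-\sqrt{v^2+4}+2$, viewed as a probability on $\mathbb{S}^1$, and $c(L)$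 is minus this infimum.
   Formalization: With the displayed definition of H, the first identity is proved with the opposite sign, H = λ_k − ∫kV_k dπ; the printed sign is false unless V_k is constant (e.g. k=2, V(0)=1, V(1/2)=0). The limits, all zero in total, are as stated. *)

theory Defs
  imports "HOL-Probability.Probability"
begin

(* The circle is R/Z: functions on it are 1-periodic functions on the real line, its points are
   represented in [0,1). *)

definition circle_C2 :: "(real \<Rightarrow> real) \<Rightarrow> bool" where
  "circle_C2 V \<longleftrightarrow>
     (\<forall>x. V (x + 1) = V x) \<and>
     (\<forall>x. V differentiable (at x)) \<and>
     (\<forall>x. deriv V differentiable (at x)) \<and>
     continuous_on UNIV (deriv (deriv V))"


(* The point j/k of Gamma_k is encoded by its index j < k; only values at indices j < k matter.
   The formulas count the two neighbours (j+1)/k and (j-1)/k separately, also when they coincide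
   (k = 2, a single neighbour reached at the doubled rate) or equal j/k (k = 1, no jumps). *)

definition nxt :: "nat \<Rightarrow> nat \<Rightarrow> nat" where
  "nxt k j = (j + 1) mod k"

definition prv :: "nat \<Rightarrow> nat \<Rightarrow> nat" where
  "prv k j = (j + k - 1) mod k"

definition lap :: "nat \<Rightarrow> (nat \<Rightarrow> real) \<Rightarrow> (nat \<Rightarrow> real)" where
  "lap k f j = f (nxt k j) + f (prv k j) - 2 * f j"

definition free_gen :: "nat \<Rightarrow> (nat \<Rightarrow> real) \<Rightarrow> (nat \<Rightarrow> real)" where
  "free_gen k f j = real k * lap k f j"

definition pot :: "(real \<Rightarrow> real) \<Rightarrow> nat \<Rightarrow> nat \<Rightarrow> real" where
  "pot V k j = V (real j / real k)"

definition pert_op :: "(real \<Rightarrow> real) \<Rightarrow> nat \<Rightarrow> (nat \<Rightarrow> real) \<Rightarrow> (nat \<Rightarrow> real)" where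
  "pert_op V k f j = real k * lap k f j + real k * pot V k j * f j"

(* exp (t A) v for a linear operator A on functions on the finite set {..<k} *)
definition exp_op :: "((nat \<Rightarrow> real) \<Rightarrow> (nat \<Rightarrow> real)) \<Rightarrow> real \<Rightarrow> (nat \<Rightarrow> real) \<Rightarrow> (nat \<Rightarrow> real)" where
  "exp_op A t v j = (\<Sum>n. t ^ n / fact n * (A ^^ n) v j)"

definition perron_triple ::
  "(real \<Rightarrow> real) \<Rightarrow> nat \<Rightarrow> real \<Rightarrow> (nat \<Rightarrow> real) \<Rightarrow> (nat \<Rightarrow> real) \<Rightarrow> bool" where
  "perron_triple V k lam u mu \<longleftrightarrow>
     (\<forall>j<k. 0 < u j) \<and>
     (\<forall>j<k. 0 \<le> mu j) \<and> (\<Sum>j<k. mu j) = 1 \<and>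
     (\<Sum>j<k. u j * mu j) = 1 \<and>
     (\<forall>j<k. pert_op V k u j = lam * u j) \<and>
     (\<forall>v. \<forall>j<k.
        ((\<lambda>t. exp (- t * lam) * exp_op (pert_op V k) t v j) \<longlongrightarrow> (\<Sum>i<k. v i * mu i) * u j) at_top)"

(* Generator of the chain jumping from x to a neighbour y at rate k u(y) / u(x). *)
definition gibbs_gen :: "nat \<Rightarrow> (nat \<Rightarrow> real) \<Rightarrow> (nat \<Rightarrow> real) \<Rightarrow> (nat \<Rightarrow> real)" where
  "gibbs_gen k u f j =
     real k * (u (nxt k j) / u j) * (f (nxt k j) - f j) +
     real k * (u (prv k j) / u j) * (f (prv k j) - f j)"

(* See gibbs_prob_sum and gibbs_prob_stationary below. *)
definition gibbs_prob :: "(nat \<Rightarrow> real) \<Rightarrow> (nat \<Rightarrow> real) \<Rightarrow> nat \<Rightarrow> real" where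
  "gibbs_prob u mu j = u j * mu j"


(* The discrete topology of nat makes these the usual cadlag step paths. *)
definition cadlag_paths :: "nat \<Rightarrow> (real \<Rightarrow> nat) set" where
  "cadlag_paths k = {\<omega> \<in> {0..} \<rightarrow>\<^sub>E {..<k}.
     (\<forall>t\<ge>0. (\<omega> \<longlongrightarrow> \<omega> t) (at_right t)) \<and>
     (\<forall>t>0. \<exists>l. (\<omega> \<longlongrightarrow> l) (at_left t))}"

(* The sigma-algebra generated by the coordinates, which is the Borel sigma-algebra of the
   Skorohod topology. *)
definition path_algebra :: "nat \<Rightarrow> (real \<Rightarrow> nat) measure" where
  "path_algebra k =
     sigma (cadlag_paths k) {{\<omega> \<in> cadlag_paths k. \<omega> t \<in> B} | t B. 0 \<le> t \<and> B \<subseteq> {..<k}}"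

definition path_past :: "nat \<Rightarrow> real \<Rightarrow> (real \<Rightarrow> nat) measure" where
  "path_past k T =
     sigma (cadlag_paths k) {{\<omega> \<in> cadlag_paths k. \<omega> t \<in> B} | t B. 0 \<le> t \<and> t \<le> T \<and> B \<subseteq> {..<k}}"

(* P is the law of the Markov chain with generator Q and initial distribution nu: the
   finite-dimensional distributions are those of the transition functions exp (t Q). *)
definition chain_law ::
  "nat \<Rightarrow> ((nat \<Rightarrow> real) \<Rightarrow> (nat \<Rightarrow> real)) \<Rightarrow> (nat \<Rightarrow> real) \<Rightarrow> (real \<Rightarrow> nat) measure \<Rightarrow> bool" where
  "chain_law k Q nu P \<longleftrightarrow>
     prob_space P \<and> space P = cadlag_paths k \<and> sets P = sets (path_algebra k) \<and>
     (\<forall>(n::nat) (t::nat \<Rightarrow> real) (x::nat \<Rightarrow> nat).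
        t 0 = 0 \<and> (\<forall>i<n. t i \<le> t (Suc i)) \<and> (\<forall>i\<le>n. x i < k) \<longrightarrow>
        measure P {\<omega> \<in> space P. \<forall>i\<le>n. \<omega> (t i) = x i} =
          nu (x 0) * (\<Prod>i<n. exp_op Q (t (Suc i) - t i) (indicator {x (Suc i)}) (x i)))"


(* log of the density of P' with respect to P on the sigma-algebra of the path up to time T *)
definition log_density ::
  "nat \<Rightarrow> (real \<Rightarrow> nat) measure \<Rightarrow> (real \<Rightarrow> nat) measure \<Rightarrow> real \<Rightarrow> (real \<Rightarrow> nat) \<Rightarrow> real" where
  "log_density k P' P T \<omega> =
     ln (enn2real (RN_deriv (restr_to_subalg P (path_past k T))
                            (restr_to_subalg P' (path_past k T)) \<omega>))"

(* With this sign the entropy is minus a relative entropy, hence nonpositive; its rate for the Gibbs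
   chain is lambda_k - int kV_k dpi, not int kV_k dpi - lambda_k. *)
definition entropy_upto :: "nat \<Rightarrow> (real \<Rightarrow> nat) measure \<Rightarrow> (real \<Rightarrow> nat) measure \<Rightarrow> real \<Rightarrow> real" where
  "entropy_upto k P' P T = - (\<integral>\<omega>. log_density k P' P T \<omega> \<partial>P')"

definition path_entropy :: "nat \<Rightarrow> (real \<Rightarrow> nat) measure \<Rightarrow> (real \<Rightarrow> nat) measure \<Rightarrow> real" where
  "path_entropy k P' P = Lim at_top (\<lambda>T. 1 / T * entropy_upto k P' P T)"

(* The quantities defining path_entropy make sense (the densities exist, their logarithms are
   integrable, the limit exists), and it equals h. *)
definition has_path_entropy ::
  "nat \<Rightarrow> (real \<Rightarrow> nat) measure \<Rightarrow> (real \<Rightarrow> nat) measure \<Rightarrow> real \<Rightarrow> bool" where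
  "has_path_entropy k P' P h \<longleftrightarrow>
     (\<forall>T\<ge>0. absolutely_continuous (restr_to_subalg P (path_past k T))
                                   (restr_to_subalg P' (path_past k T)) \<and>
            integrable P' (log_density k P' P T)) \<and>
     ((\<lambda>T. 1 / T * entropy_upto k P' P T) \<longlongrightarrow> h) at_top"

lemma has_path_entropy_imp_eq: "has_path_entropy k P' P h \<Longrightarrow> path_entropy k P' P = h"
  unfolding has_path_entropy_def path_entropy_def by (intro tendsto_Lim) auto


definition Lagr :: "(real \<Rightarrow> real) \<Rightarrow> real \<Rightarrow> real \<Rightarrow> real" where
  "Lagr V x v = - V x + v * ln ((v + sqrt (v\<^sup>2 + 4)) / 2) - sqrt (v\<^sup>2 + 4) + 2"

(* d/dt (dL/dv (g, g')) = dL/dx (g, g'), for a curve g lifted to the real line *)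
definition EL_solution :: "(real \<Rightarrow> real) \<Rightarrow> (real \<Rightarrow> real) \<Rightarrow> bool" where
  "EL_solution V g \<longleftrightarrow>
     (\<forall>t. g differentiable (at t)) \<and>
     (\<forall>t. ((\<lambda>s. deriv (\<lambda>w. Lagr V (g s) w) (deriv g s))
            has_real_derivative deriv (\<lambda>y. Lagr V y (deriv g t)) (g t)) (at t))"

(* F is the Euler-Lagrange flow (t, (x, v)) |-> (position, velocity), lifted to the universal
   cover R x R of the tangent bundle of the circle. It is global because the energy
   sqrt (v^2 + 4) - 2 + V x is conserved. *)
definition EL_flow :: "(real \<Rightarrow> real) \<Rightarrow> (real \<Rightarrow> real \<times> real \<Rightarrow> real \<times> real) \<Rightarrow> bool" where
  "EL_flow V F \<longleftrightarrow>
     continuous_on UNIV (\<lambda>(t, z). F t z) \<and>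
     (\<forall>z. F 0 z = z \<and>
          EL_solution V (\<lambda>t. fst (F t z)) \<and>
          (\<forall>t. snd (F t z) = deriv (\<lambda>s. fst (F s z)) t))"

definition circle_alg :: "real measure" where
  "circle_alg = restrict_space borel {0..<1}"

definition tangent_alg :: "(real \<times> real) measure" where
  "tangent_alg = restrict_space borel ({0..<1} \<times> UNIV)"

definition to_tangent :: "real \<times> real \<Rightarrow> real \<times> real" where
  "to_tangent z = (frac (fst z), snd z)"

definition invariant_probs :: "(real \<Rightarrow> real \<times> real \<Rightarrow> real \<times> real) \<Rightarrow> (real \<times> real) measure set" where
  "invariant_probs F =
     {m. prob_space m \<and> sets m = sets tangent_alg \<and>
         (\<forall>t. distr m tangent_alg (\<lambda>z. to_tangent (F t z)) = m)}"

definition action :: "(real \<Rightarrow> real) \<Rightarrow> (real \<times> real) measure \<Rightarrow> real" where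
  "action V m = (\<integral>z. Lagr V (fst z) (snd z) \<partial>m)"

(* The Lagrangian is bounded below, so a probability for which it is not integrable has action
   +infinity and does not contribute to the infimum; the Bochner integral would be 0 there. *)
definition finite_action_probs ::
  "(real \<Rightarrow> real) \<Rightarrow> (real \<Rightarrow> real \<times> real \<Rightarrow> real \<times> real) \<Rightarrow> (real \<times> real) measure set" where
  "finite_action_probs V F =
     {m \<in> invariant_probs F. integrable m (\<lambda>z. Lagr V (fst z) (snd z))}"

definition min_action :: "(real \<Rightarrow> real) \<Rightarrow> (real \<Rightarrow> real \<times> real \<Rightarrow> real \<times> real) \<Rightarrow> real" where
  "min_action V F = (INF m\<in>finite_action_probs V F. action V m)"

(* c(L) *)
definition crit_value :: "(real \<Rightarrow> real) \<Rightarrow> (real \<Rightarrow> real \<times> real \<Rightarrow> real \<times> real) \<Rightarrow> real" where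
  "crit_value V F = - min_action V F"

(* nu is a Mather measure, viewed (by projection) as a probability on the circle *)
definition is_mather_measure ::
  "(real \<Rightarrow> real) \<Rightarrow> (real \<Rightarrow> real \<times> real \<Rightarrow> real \<times> real) \<Rightarrow> real measure \<Rightarrow> bool" where
  "is_mather_measure V F nu \<longleftrightarrow>
     (\<exists>m \<in> finite_action_probs V F. action V m = min_action V F \<and> nu = distr m circle_alg fst)"

lemma gibbs_prob_sum:
  assumes "perron_triple V k lam u mu"
  shows "(\<Sum>j<k. gibbs_prob u mu j) = 1" "j < k \<Longrightarrow> 0 \<le> gibbs_prob u mu j"
  using assms by (auto simp: perron_triple_def gibbs_prob_def intro: less_imp_le)

lemma nxt_less: "j < k \<Longrightarrow> nxt k j < k" and prv_less: "j < k \<Longrightarrow> prv k j < k"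
  by (auto simp: nxt_def prv_def)

lemma pert_op_pow_bound:
  assumes C: "\<And>i. i < k \<Longrightarrow> 4 * real k + real k * \<bar>pot V k i\<bar> \<le> C"
    and M: "\<And>i. i < k \<Longrightarrow> \<bar>v i\<bar> \<le> M" and j: "j < k"
  shows "\<bar>(pert_op V k ^^ n) v j\<bar> \<le> C ^ n * M"
  using j
proof (induction n arbitrary: j)
  case 0 then show ?case using M by simp
next
  case (Suc n)
  define w where "w = (pert_op V k ^^ n) v"
  define B where "B = C ^ n * M"
  have w: "\<bar>w i\<bar> \<le> B" if "i < k" for i using Suc.IH[OF that] by (simp add: w_def B_def)
  have B0: "0 \<le> B" using w[OF Suc.prems] by linarith
  have "\<bar>lap k w j\<bar> \<le> 4 * B"
    using w[OF nxt_less[OF Suc.prems]] w[OF prv_less[OF Suc.prems]] w[OF Suc.prems]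
    by (auto simp: lap_def)
  then have 1: "\<bar>real k * lap k w j\<bar> \<le> real k * (4 * B)"
    by (simp add: abs_mult mult_left_mono)
  have 2: "\<bar>real k * pot V k j * w j\<bar> \<le> real k * \<bar>pot V k j\<bar> * B"
    using w[OF Suc.prems] by (simp add: abs_mult mult_left_mono)
  have "\<bar>pert_op V k w j\<bar> \<le> (4 * real k + real k * \<bar>pot V k j\<bar>) * B"
    using 1 2 abs_triangle_ineq[of "real k * lap k w j" "real k * pot V k j * w j"]
    by (simp add: pert_op_def algebra_simps)
  also have "\<dots> \<le> C * B" using C[OF Suc.prems] B0 by (rule mult_right_mono)
  finally show ?case by (simp add: w_def B_def mult.assoc)
qed

lemma pert_op_summable:
  assumes "j < k"
  shows "summable (\<lambda>n. t ^ n / fact n * (pert_op V k ^^ n) v j)"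
proof -
  define C where "C = (\<Sum>i<k. 4 * real k + real k * \<bar>pot V k i\<bar>)"
  define M where "M = (\<Sum>i<k. \<bar>v i\<bar>)"
  have C: "4 * real k + real k * \<bar>pot V k i\<bar> \<le> C" if "i < k" for i
    unfolding C_def using that by (intro member_le_sum) auto
  have M: "\<bar>v i\<bar> \<le> M" if "i < k" for i
    unfolding M_def using that by (intro member_le_sum) auto
  have "summable (\<lambda>n. inverse (fact n) * (\<bar>t\<bar> * C) ^ n * M)"
    by (intro summable_mult2 summable_exp)
  then show ?thesis
  proof (rule summable_comparison_test'[of _ 0])
    fix n
    have "norm (t ^ n / fact n * (pert_op V k ^^ n) v j)
        = \<bar>t\<bar> ^ n / fact n * \<bar>(pert_op V k ^^ n) v j\<bar>"
      by (simp add: abs_mult power_abs)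
    also have "\<dots> \<le> \<bar>t\<bar> ^ n / fact n * (C ^ n * M)"
      by (intro mult_left_mono pert_op_pow_bound[OF C M assms]) auto
    finally show "norm (t ^ n / fact n * (pert_op V k ^^ n) v j) \<le> inverse (fact n) * (\<bar>t\<bar> * C) ^ n * M"
      by (simp add: field_simps)
  qed
qed

lemma exp_op_pert_op_commute:
  assumes j: "j < k"
  shows "exp_op (pert_op V k) t (pert_op V k v) j = pert_op V k (exp_op (pert_op V k) t v) j"
proof -
  let ?A = "pert_op V k"
  let ?c = "\<lambda>n. t ^ n / fact n :: real"
  have s: "(\<lambda>n. ?c n * (?A ^^ n) v i) sums exp_op ?A t v i" if "i < k" for i
    unfolding exp_op_def using pert_op_summable[OF that] by (rule summable_sums)
  have "(\<lambda>n. real k * (?c n * (?A ^^ n) v (nxt k j) + ?c n * (?A ^^ n) v (prv k j)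
             - 2 * (?c n * (?A ^^ n) v j)) + real k * pot V k j * (?c n * (?A ^^ n) v j))
        sums (?A (exp_op ?A t v) j)"
    unfolding pert_op_def[of V k "exp_op ?A t v"] lap_def
    by (intro sums_add sums_diff sums_mult s nxt_less prv_less j)
  then have "(\<lambda>n. ?c n * ?A ((?A ^^ n) v) j) sums (?A (exp_op ?A t v) j)"
    by (simp add: pert_op_def[of V k "(?A ^^ _) v"] lap_def algebra_simps)
  then show ?thesis
    unfolding exp_op_def by (simp add: sums_iff funpow_swap1)
qed

lemma gibbs_prob_stationary:
  assumes P: "perron_triple V k lam u mu"
  shows "(\<Sum>j<k. gibbs_prob u mu j * gibbs_gen k u f j) = 0"
proof (cases "k = 0")
  case False
  let ?A = "pert_op V k"
  define m where "m v = (\<Sum>i<k. v i * mu i)" for v :: "nat \<Rightarrow> real"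
  from P have pos: "\<And>j. j < k \<Longrightarrow> 0 < u j" and eig: "\<And>j. j < k \<Longrightarrow> ?A u j = lam * u j"
    and lim: "\<And>v j. j < k \<Longrightarrow> ((\<lambda>t. exp (- t * lam) * exp_op ?A t v j) \<longlongrightarrow> m v * u j) at_top"
    unfolding perron_triple_def m_def by auto
  have left: "m (?A w) = lam * m w" for w
  proof -
    let ?e = "\<lambda>t. exp (- t * lam)"
    have 0: "0 < k" using False by simp
    have "((\<lambda>t. real k * (?e t * exp_op ?A t w (nxt k 0) + ?e t * exp_op ?A t w (prv k 0)
             - 2 * (?e t * exp_op ?A t w 0)) + real k * pot V k 0 * (?e t * exp_op ?A t w 0))
          \<longlongrightarrow> real k * (m w * u (nxt k 0) + m w * u (prv k 0) - 2 * (m w * u 0))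
              + real k * pot V k 0 * (m w * u 0)) at_top"
      by (intro tendsto_intros lim nxt_less prv_less 0)
    moreover have "real k * (m w * u (nxt k 0) + m w * u (prv k 0) - 2 * (m w * u 0))
              + real k * pot V k 0 * (m w * u 0) = m w * ?A u 0"
      by (simp add: pert_op_def lap_def algebra_simps)
    moreover have "(\<lambda>t. real k * (?e t * exp_op ?A t w (nxt k 0) + ?e t * exp_op ?A t w (prv k 0)
             - 2 * (?e t * exp_op ?A t w 0)) + real k * pot V k 0 * (?e t * exp_op ?A t w 0))
        = (\<lambda>t. ?e t * exp_op ?A t (?A w) 0)"
      unfolding exp_op_pert_op_commute[OF 0]
      by (simp add: pert_op_def[of V k "exp_op _ _ _"] lap_def algebra_simps)
    ultimately have "((\<lambda>t. ?e t * exp_op ?A t (?A w) 0) \<longlongrightarrow> m w * (lam * u 0)) at_top"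
      using eig[OF 0] by simp
    from tendsto_unique[OF _ this lim[OF 0]] have "m w * (lam * u 0) = m (?A w) * u 0" by simp
    then show ?thesis using pos[OF 0] by (simp add: mult.commute)
  qed
  define w where "w i = u i * f i" for i
  have "gibbs_prob u mu j * gibbs_gen k u f j = ?A w j * mu j - lam * (w j * mu j)" if "j < k" for j
  proof -
    have "u j * gibbs_gen k u f j = ?A w j - f j * ?A u j"
      using pos[OF that] by (simp add: gibbs_gen_def pert_op_def lap_def w_def field_simps)
    then have "mu j * (u j * gibbs_gen k u f j) = mu j * (?A w j - f j * (lam * u j))"
      by (simp add: eig[OF that])
    then show ?thesis
      by (simp add: gibbs_prob_def w_def right_diff_distrib mult.commute mult.left_commute)
  qed
  then have "(\<Sum>j<k. gibbs_prob u mu j * gibbs_gen k u f j) = m (?A w) - lam * m w"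
    by (simp add: m_def sum_subtractf sum_distrib_left)
  then show ?thesis by (simp add: left)
qed simp

end

theory Submission
  imports Defs
begin

text \<open>
Write \<open>\<lambda>\<close> for \<open>lam k\<close>, \<open>u\<close> for the Perron eigenfunction, \<open>\<pi>\<close> for the stationary probability
\<open>u mu\<close> and \<open>c = kV - \<lambda>\<close>. Because \<open>(kL + kV) u = \<lambda> u\<close>, the Gibbs chain is the Doob transform of the
free chain by \<open>u\<close>, and its law up to time \<open>T\<close> has density
\<open>Z = u (X T) / u (X 0) * exp (\<integral> c (X s) ds)\<close>, the integral running over \<open>(0, T]\<close>, with respect to the
free law with the same initial distribution (\<open>gibbs_law_density\<close>). Under the stationary Gibbs law
the two terms \<open>ln u\<close> of \<open>ln Z\<close> have the same mean, so that \<open>ln Z\<close> has mean \<open>T * (\<integral> kV d\<pi> - \<lambda>)\<close>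
(\<open>gibbs_log_density_integral\<close>); this is the entropy rate up to its sign.

A law is known only through its finite-dimensional distributions, so the density is identified on the
events that prescribe the path at the times \<open>i T / 2^m\<close>. By right continuity these generate the
past up to \<open>T\<close> (\<open>sets_path_past_dyadic\<close>), and they are stable under intersection. Right continuity
also makes the right Riemann sums of \<open>c (X s)\<close> along the dyadic meshes converge on every path. If the
integral in \<open>Z\<close> is replaced by such a sum of mesh \<open>h\<close>, the expectation of \<open>Z\<close> on a
cylinder becomes a product of powers of the single kernel
\<open>K h x y = p h x y * exp (h * c y) * u y / u x\<close>, where \<open>p h\<close> is the free transition probability
(\<open>riemann_density_cylinder_integral\<close>). This kernel is the identity at \<open>h = 0\<close> and its derivative
there is the Gibbs generator, which is where the eigenvalue equation enters. A one-step scheme with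
these two properties converges to the semigroup (\<open>product_formula\<close>), so the limit is the probability
of the cylinder under the Gibbs law. This is the Feynman-Kac formula, proved together with
the Trotter product formula behind it.

For the limit \<open>k \<rightarrow> \<infinity>\<close>, the eigenvalue equation at a maximum of \<open>u\<close> gives \<open>\<lambda> / k \<le> max V\<close>. Summing
the equation divided by \<open>u\<close> over a block of \<open>r\<close> consecutive sites near a maximum of \<open>V\<close>, and using
\<open>a / b + b / a \<ge> 2\<close> for each edge inside the block, loses only \<open>2 / r\<close>
(\<open>perron_block_bound\<close>), whence \<open>\<lambda> / k \<longrightarrow> max V\<close>. Relative entropy is nonnegative, which here is the
inequality \<open>\<lambda> \<le> \<integral> kV d\<pi>\<close> (\<open>perron_value_le_potential_average\<close>); so \<open>\<integral> V d\<pi>\<close> is squeezed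
between \<open>\<lambda> / k\<close> and \<open>max V\<close>, and the rescaled entropy tends to zero.

For the Mather measure, \<open>L (x, v) \<ge> - V x\<close> with equality exactly for \<open>v = 0\<close>. Hence no action is below
\<open>- max V\<close>, and a minimiser lives over the maximum points with zero velocity. The bound is attained by the
Dirac measure at \<open>(x0, 0)\<close>, which is invariant because the solution starting there is constant
(\<open>EL_solution_at_max_constant\<close>).
\<close>

section \<open>The growth rate of the Perron eigenvalue\<close>

lemma perron_eigen_ratio:
  assumes "perron_triple V k lam u mu" "j < k"
  shows "lam = real k * (u (nxt k j) / u j + u (prv k j) / u j - 2) + real k * pot V k j"
proof -
  have "pert_op V k u j = lam * u j" and "u j > 0" using assms by (auto simp: perron_triple_def)
  then show ?thesis by (simp add: pert_op_def lap_def field_simps)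
qed

lemma perron_value_le:
  assumes P: "perron_triple V k lam u mu" and k: "k \<ge> 1" and M: "\<And>x. V x \<le> M"
  shows "lam \<le> real k * M"
proof -
  define m where "m = Max (u ` {..<k})"
  have "m \<in> u ` {..<k}" unfolding m_def using k by (intro Max_in) (auto simp: lessThan_empty_iff)
  then obtain j where j: "j < k" "u j = m" by auto
  have le: "u i \<le> u j" if "i < k" for i unfolding j(2) m_def using that by (intro Max_ge) auto
  have pos: "0 < u j" using P j(1) by (auto simp: perron_triple_def)
  have "u (nxt k j) / u j \<le> 1" "u (prv k j) / u j \<le> 1"
    using le[OF nxt_less[OF j(1)]] le[OF prv_less[OF j(1)]] pos by simp_all
  then have "real k * (u (nxt k j) / u j + u (prv k j) / u j - 2) \<le> 0"
    by (intro mult_nonneg_nonpos) auto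
  moreover have "real k * pot V k j \<le> real k * M"
    unfolding pot_def by (intro mult_left_mono M) auto
  ultimately show ?thesis using perron_eigen_ratio[OF P j(1)] by linarith
qed

lemma add_inverse_ratio_ge_2:
  fixes a b :: real assumes "0 < a" "0 < b" shows "2 \<le> a / b + b / a"
proof -
  have "0 \<le> (a - b)\<^sup>2" by simp
  then show ?thesis using assms by (simp add: field_simps power2_eq_square)
qed

text \<open>Induction on the right end of the block, keeping the ratio that belongs to the edge leaving the
block on the right: adding a site pairs that ratio with its inverse, and the two cancel the \<open>- 2\<close> of
the new site. Only the two ends of the block, with loss \<open>1\<close> each, remain uncompensated. The
result is the Rayleigh quotient bound for the indicator of the block.\<close>

lemma perron_block_bound:
  assumes P: "perron_triple V k lam u mu" and ab: "a \<le> b" "b < k"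
    and c: "\<And>j. a \<le> j \<Longrightarrow> j \<le> b \<Longrightarrow> c \<le> pot V k j"
  shows "real k * ((real b - real a + 1) * c - 2) \<le> (real b - real a + 1) * lam"
proof -
  have pos: "\<And>j. j < k \<Longrightarrow> 0 < u j" using P by (auto simp: perron_triple_def)
  have "real k * ((real b - real a + 1) * c - 2 + u (nxt k b) / u b) \<le> (real b - real a + 1) * lam"
    using ab c
  proof (induction b rule: dec_induct)
    case base
    have "0 < u (prv k a) / u a" using base.prems by (auto intro!: divide_pos_pos pos prv_less)
    then have "c - 2 + u (nxt k a) / u a
        \<le> u (nxt k a) / u a + u (prv k a) / u a - 2 + pot V k a" using base.prems(2)[of a] by simp
    from mult_left_mono[OF this, of "real k"] perron_eigen_ratio[OF P base.prems(1)]
    show ?case by (simp add: distrib_left)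
  next
    case (step b)
    have b: "Suc b < k" by fact
    have nx: "nxt k b = Suc b" using b by (simp add: nxt_def)
    have pr: "prv k (Suc b) = b" using b by (simp add: prv_def)
    have 2: "2 \<le> u (Suc b) / u b + u b / u (Suc b)"
      using b by (intro add_inverse_ratio_ge_2 pos) auto
    have IH: "real k * ((real b - real a + 1) * c - 2 + u (Suc b) / u b) \<le> (real b - real a + 1) * lam"
      using step unfolding nx by auto
    \<comment> \<open>replaces the ratio kept for the edge leaving \<open>b\<close> by the one for the edge leaving \<open>Suc b\<close>\<close>
    have "c + (- u (Suc b) / u b) + u (nxt k (Suc b)) / u (Suc b)
        \<le> u (nxt k (Suc b)) / u (Suc b) + u (prv k (Suc b)) / u (Suc b) - 2 + pot V k (Suc b)"
      using step.prems(2)[of "Suc b"] step.hyps 2 unfolding pr by simp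
    from mult_left_mono[OF this, of "real k"] perron_eigen_ratio[OF P b] IH
    show ?case by (simp add: algebra_simps)
  qed
  moreover have "0 < u (nxt k b) / u b" using ab by (auto intro!: divide_pos_pos pos nxt_less)
  ultimately show ?thesis
    by (smt (verit) mult_left_mono of_nat_0_le_iff)
qed

text \<open>The lower bound uses the lattice points in an interval \<open>[x0, x0 + d]\<close> to the right of the maximum
point, which stays inside \<open>[0, 1)\<close>; it contains at least \<open>k d - 1\<close> of them, so the loss per site
vanishes.\<close>

lemma perron_value_tendsto:
  assumes P: "\<And>k. k \<ge> 1 \<Longrightarrow> perron_triple V k (lam k) (u k) (mu k)"
    and cont: "isCont V x0" and x0: "x0 \<in> {0..<1}" and max: "\<And>x. V x \<le> V x0"
  shows "(\<lambda>k. lam k / real k) \<longlonglongrightarrow> V x0"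
proof (rule LIMSEQ_I)
  fix e :: real assume e: "0 < e"
  obtain d0 where d0: "d0 > 0" "\<And>y. \<bar>y - x0\<bar> < d0 \<Longrightarrow> \<bar>V y - V x0\<bar> < e / 2"
    using cont e unfolding continuous_at_eps_delta by (metis dist_real_def half_gt_zero)
  define d where "d = min (d0 / 2) ((1 - x0) / 2)"
  have d: "d > 0" "d < d0" "x0 + d < 1" using d0 x0 by (auto simp: d_def min_def field_simps)
  have near: "V x0 - e / 2 \<le> V y" if "x0 \<le> y" "y \<le> x0 + d" for y
    using d0(2)[of y] that d by (auto simp: abs_if split: if_splits)
  obtain N :: nat where N: "real N > (1 + 4 / e) / d" "N \<ge> 1"
    by (metis reals_Archimedean2 le_max_iff_disj max.strict_coboundedI1 nle_le of_nat_max order.refl)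
  show "\<exists>no. \<forall>n\<ge>no. norm (lam n / real n - V x0) < e"
  proof (intro exI allI impI)
    fix k assume "k \<ge> N"
    then have k: "k \<ge> 1" "real k \<ge> real N" using N by auto
    then have kd: "real k * d - 1 > 4 / e" using N d
      by (smt (verit, best) divide_less_eq)
    define a where "a = nat \<lceil>x0 * real k\<rceil>"
    define b where "b = nat \<lfloor>(x0 + d) * real k\<rfloor>"
    have a: "x0 * real k \<le> real a" "real a < x0 * real k + 1"
      using x0 unfolding a_def by (auto simp: real_nat_ceiling_ge) (smt (verit) ceiling_correct of_nat_nat
        zero_le_ceiling mult_nonneg_nonneg of_nat_0_le_iff)
    have b: "real b \<le> (x0 + d) * real k" "(x0 + d) * real k < real b + 1"
      using x0 d unfolding b_def by (auto simp: of_nat_floor)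
    have len: "4 / e < real b - real a + 1" using a b kd by (simp add: algebra_simps)
    have kdp: "real k * d > 1" using kd e by (smt (verit) divide_pos_pos)
    have "real a < real b + 1" using len e by (smt (verit) divide_pos_pos)
    then have ab: "a \<le> b" by simp
    have "real b < real k" using b(1) d(3) k by (smt (verit) mult_less_cancel_right2 of_nat_1 of_nat_mono)
    then have bk: "b < k" by simp
    have "V x0 - e / 2 \<le> pot V k j" if "a \<le> j" "j \<le> b" for j
    proof -
      have "x0 * real k \<le> real j" "real j \<le> (x0 + d) * real k" using that a(1) b(1) by linarith+
      then show ?thesis unfolding pot_def using k by (intro near) (auto simp: field_simps)
    qed
    from perron_block_bound[OF P[OF k(1)] ab bk this]
    have *: "real k * ((real b - real a + 1) * (V x0 - e / 2) - 2) \<le> (real b - real a + 1) * lam k" by simp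
    define r where "r = real b - real a + 1"
    have r: "r > 4 / e" "r > 0" using len e unfolding r_def by (auto intro: less_trans[of 0 "4/e"])
    have kp: "real k > 0" using k by simp
    have "V x0 - e / 2 - 2 / r \<le> lam k / real k"
      using * r kp unfolding r_def[symmetric] by (simp add: field_simps)
    moreover have "2 / r < e / 2" using r e by (simp add: field_simps)
    moreover have "lam k / real k \<le> V x0"
      using perron_value_le[OF P[OF k(1)] k(1) max] kp by (simp add: field_simps)
    ultimately show "norm (lam k / real k - V x0) < e" by (simp add: abs_if)
  qed
qed

text \<open>Stationarity of \<open>gibbs_prob\<close> tested on \<open>ln u\<close>: since \<open>r ln r \<ge> r - 1\<close>, the Gibbs generator
applied to \<open>ln u\<close> is at least the free generator applied to \<open>u\<close>, divided by \<open>u\<close>, and the latter equals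
\<open>lam - kV\<close>.\<close>

lemma perron_value_le_potential_average:
  assumes P: "perron_triple V k lam u mu"
  shows "lam \<le> (\<Sum>j<k. real k * pot V k j * gibbs_prob u mu j)"
proof -
  have pos: "\<And>j. j < k \<Longrightarrow> 0 < u j" using P by (auto simp: perron_triple_def)
  have entr: "r - 1 \<le> r * ln r" if "0 < r" for r :: real
    using ln_add_one_self_le_self2[of "1 / r - 1"] that by (simp add: ln_div field_simps)
  have "lam - real k * pot V k j \<le> gibbs_gen k u (\<lambda>i. ln (u i)) j" if j: "j < k" for j
  proof -
    have "lam - real k * pot V k j = real k * (u (nxt k j) / u j - 1) + real k * (u (prv k j) / u j - 1)"
      using perron_eigen_ratio[OF P j] by (simp add: algebra_simps)
    also have "\<dots> \<le> real k * (u (nxt k j) / u j * ln (u (nxt k j) / u j))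
                 + real k * (u (prv k j) / u j * ln (u (prv k j) / u j))"
      using j by (intro add_mono mult_left_mono entr divide_pos_pos pos nxt_less prv_less) auto
    also have "\<dots> = gibbs_gen k u (\<lambda>i. ln (u i)) j"
      unfolding gibbs_gen_def using pos[OF j] pos[OF nxt_less[OF j]] pos[OF prv_less[OF j]]
      by (simp add: ln_div)
    finally show ?thesis .
  qed
  then have "(\<Sum>j<k. gibbs_prob u mu j * (lam - real k * pot V k j))
      \<le> (\<Sum>j<k. gibbs_prob u mu j * gibbs_gen k u (\<lambda>i. ln (u i)) j)"
    by (intro sum_mono mult_left_mono gibbs_prob_sum(2)[OF P]) auto
  also have "\<dots> = 0" by (rule gibbs_prob_stationary[OF P])
  finally have "(\<Sum>j<k. gibbs_prob u mu j) * lam \<le> (\<Sum>j<k. real k * pot V k j * gibbs_prob u mu j)"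
    by (simp add: algebra_simps sum_subtractf sum_distrib_left)
  then show ?thesis by (simp add: gibbs_prob_sum(1)[OF P])
qed

lemma gibbs_average_tendsto:
  assumes P: "\<And>k. k \<ge> 1 \<Longrightarrow> perron_triple V k (lam k) (u k) (mu k)"
    and lim: "(\<lambda>k. lam k / real k) \<longlonglongrightarrow> M" and max: "\<And>x. V x \<le> M"
  shows "(\<lambda>k. \<Sum>j<k. pot V k j * gibbs_prob (u k) (mu k) j) \<longlonglongrightarrow> M"
proof (rule tendsto_sandwich[OF _ _ lim tendsto_const])
  show "\<forall>\<^sub>F k in sequentially. lam k / real k \<le> (\<Sum>j<k. pot V k j * gibbs_prob (u k) (mu k) j)"
  proof (rule eventually_sequentiallyI)
    fix k :: nat assume k: "1 \<le> k"
    have "lam k \<le> real k * (\<Sum>j<k. pot V k j * gibbs_prob (u k) (mu k) j)"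
      using perron_value_le_potential_average[OF P[OF k]] by (simp add: sum_distrib_left mult.assoc)
    then show "lam k / real k \<le> (\<Sum>j<k. pot V k j * gibbs_prob (u k) (mu k) j)"
      using k by (simp add: field_simps)
  qed
  show "\<forall>\<^sub>F k in sequentially. (\<Sum>j<k. pot V k j * gibbs_prob (u k) (mu k) j) \<le> M"
  proof (rule eventually_sequentiallyI)
    fix k :: nat assume k: "1 \<le> k"
    have "(\<Sum>j<k. pot V k j * gibbs_prob (u k) (mu k) j) \<le> (\<Sum>j<k. M * gibbs_prob (u k) (mu k) j)"
      unfolding pot_def by (intro sum_mono mult_right_mono max gibbs_prob_sum(2)[OF P[OF k]]) auto
    also have "\<dots> = M" by (simp flip: sum_distrib_left add: gibbs_prob_sum(1)[OF P[OF k]])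
    finally show "(\<Sum>j<k. pot V k j * gibbs_prob (u k) (mu k) j) \<le> M" .
  qed
qed

section \<open>Invariant measures of minimal action\<close>

lemma circle_C2_frac:
  assumes "circle_C2 V" shows "V (frac x) = V x"
proof -
  interpret periodic_fun_simple' V using assms by unfold_locales (auto simp: circle_C2_def)
  show ?thesis using plus_of_int[of x "- \<lfloor>x\<rfloor>"] by (simp add: frac_def)
qed

lemma circle_C2_attains_max:
  assumes "circle_C2 V" obtains x0 where "x0 \<in> {0..<1}" "\<And>x. V x \<le> V x0"
proof -
  have "continuous_on {0..1} V"
    using assms by (auto simp: circle_C2_def intro!: differentiable_imp_continuous_on
        differentiable_at_imp_differentiable_on)
  then obtain z where z: "z \<in> {0..1}" "\<And>y. y \<in> {0..1} \<Longrightarrow> V y \<le> V z"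
    using continuous_attains_sup[of "{0..1::real}" V] by auto
  have "V x \<le> V (frac z)" for x
    using z(2)[of "frac x"] frac_lt_1[of x] circle_C2_frac[OF assms] by simp
  then show ?thesis using that[of "frac z"] frac_lt_1[of z] by simp
qed

lemma circle_C2_second_deriv_bounded:
  assumes "circle_C2 V" obtains M where "\<And>x. \<bar>deriv (deriv V) x\<bar> \<le> M"
proof -
  have per: "\<And>x. V (x + 1) = V x" and cont: "continuous_on UNIV (deriv (deriv V))"
    using assms by (auto simp: circle_C2_def)
  have d1: "deriv f (x + 1) = deriv f x" if "\<And>x. f (x + 1) = f x" for f :: "real \<Rightarrow> real" and x
    using DERIV_shift[of f _ x 1] that by (simp add: deriv_def)
  interpret periodic_fun_simple' "deriv (deriv V)"
    by unfold_locales (intro d1 per)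
  have "compact (deriv (deriv V) ` {0..1})"
    by (intro compact_continuous_image continuous_on_subset[OF cont]) auto
  then obtain M where M: "\<And>y. y \<in> {0..1} \<Longrightarrow> \<bar>deriv (deriv V) y\<bar> \<le> M"
    using compact_imp_bounded by (fastforce simp: bounded_iff)
  have "\<bar>deriv (deriv V) x\<bar> \<le> M" for x
    using M[of "frac x"] frac_lt_1[of x] plus_of_int[of x "- \<lfloor>x\<rfloor>"] by (simp add: frac_def)
  then show ?thesis by (rule that)
qed

text \<open>Together with energy conservation this bounds the speed of a solution linearly in its distance to
\<open>x0\<close>; it is the place where the second derivative of \<open>V\<close> enters.\<close>

lemma circle_C2_quadratic_max:
  assumes V: "circle_C2 V" and max: "\<And>x. V x \<le> V x0"
  obtains M where "M \<ge> 0" "\<And>x. V x0 - V x \<le> M * (x - x0)\<^sup>2"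
proof -
  obtain M where M: "\<And>x. \<bar>deriv (deriv V) x\<bar> \<le> M"
    using circle_C2_second_deriv_bounded[OF V] by blast
  have D: "(V has_real_derivative deriv V x) (at x)"
    "(deriv V has_real_derivative deriv (deriv V) x) (at x)" for x
    using V by (auto simp: circle_C2_def DERIV_deriv_iff_real_differentiable)
  have crit: "deriv V x0 = 0"
    using DERIV_local_max[OF D(1), of 1 x0] max by auto
  have "V x0 - V x \<le> M / 2 * (x - x0)\<^sup>2" for x
  proof (cases "x = x0")
    case False
    define diff where "diff m = (if m = 0 then V else if m = 1 then deriv V else deriv (deriv V))"
      for m :: nat
    have "\<exists>t. (if x < x0 then x < t \<and> t < x0 else x0 < t \<and> t < x) \<and>
        V x = (\<Sum>m<2. diff m x0 / fact m * (x - x0) ^ m) + diff 2 t / fact 2 * (x - x0) ^ 2"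
      using False
      by (intro Taylor[where a = "min x x0" and b = "max x x0"])
         (auto simp: diff_def D less_Suc_eq numeral_2_eq_2)
    then obtain t where "V x = V x0 + deriv (deriv V) t / 2 * (x - x0)\<^sup>2"
      by (auto simp: diff_def crit numeral_2_eq_2)
    moreover have "- deriv (deriv V) t / 2 * (x - x0)\<^sup>2 \<le> M / 2 * (x - x0)\<^sup>2"
      using M[of t] by (intro mult_right_mono) auto
    ultimately show ?thesis by simp
  qed simp
  moreover have "M \<ge> 0" using M[of 0] by linarith
  ultimately show ?thesis using that[of "M / 2"] by simp
qed

text \<open>Gronwall's inequality for \<open>h\<^sup>2\<close>, run forwards and backwards in time.\<close>

lemma linear_growth_imp_zero:
  fixes h h' :: "real \<Rightarrow> real"
  assumes D: "\<And>t. (h has_real_derivative h' t) (at t)" and le: "\<And>t. \<bar>h' t\<bar> \<le> C * \<bar>h t\<bar>"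
    and 0: "h 0 = 0"
  shows "h t = 0"
proof -
  have forward: "f t = 0"
    if D: "\<And>t. (f has_real_derivative f' t) (at t)" and le: "\<And>t. \<bar>f' t\<bar> \<le> C * \<bar>f t\<bar>"
      and 0: "f 0 = 0" and t: "0 \<le> t" for f f' :: "real \<Rightarrow> real" and t
  proof -
    let ?\<phi> = "\<lambda>t. (f t)\<^sup>2 * exp (- 2 * C * t)"
    have "?\<phi> t \<le> ?\<phi> 0"
    proof (rule DERIV_nonpos_imp_nonincreasing[OF t], intro exI conjI)
      fix s
      show "(?\<phi> has_real_derivative (2 * f s * f' s - 2 * C * (f s)\<^sup>2) * exp (- 2 * C * s)) (at s)"
        by (auto intro!: derivative_eq_intros D simp: algebra_simps)
      have "f s * f' s \<le> \<bar>f s\<bar> * \<bar>f' s\<bar>" by (metis abs_ge_self abs_mult)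
      also have "\<dots> \<le> \<bar>f s\<bar> * (C * \<bar>f s\<bar>)" by (intro mult_left_mono le) auto
      also have "\<dots> = C * (f s)\<^sup>2" by (simp add: power2_eq_square)
      finally show "(2 * f s * f' s - 2 * C * (f s)\<^sup>2) * exp (- 2 * C * s) \<le> 0"
        by (intro mult_nonpos_nonneg) auto
    qed
    then have "(f t)\<^sup>2 * exp (- 2 * C * t) \<le> 0" using 0 by simp
    then show ?thesis by (simp add: mult_le_0_iff not_le)
  qed
  show ?thesis
  proof (cases "0 \<le> t")
    case True then show ?thesis using forward[OF D le 0] by simp
  next
    case False
    have "((\<lambda>s. h (- s)) has_real_derivative - h' (- s)) (at s)" for s
      using DERIV_mirror[of h "h' (- s)" s] D[of "- s"] by simp
    from forward[OF this, of "- t"] show ?thesis using le 0 False by simp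
  qed
qed

lemma Lagr_arsinh: "Lagr V x v = - V x + v * arsinh (v / 2) - sqrt (v\<^sup>2 + 4) + 2"
proof -
  have "sqrt ((v / 2)\<^sup>2 + 1) = sqrt ((v\<^sup>2 + 4) / 4)" by (simp add: power_divide field_simps)
  also have "\<dots> = sqrt (v\<^sup>2 + 4) / 2" by (simp add: real_sqrt_divide)
  finally have "arsinh (v / 2) = ln ((v + sqrt (v\<^sup>2 + 4)) / 2)"
    unfolding arsinh_real_def by (simp only: add_divide_distrib)
  then show ?thesis by (simp add: Lagr_def)
qed

lemma sqrt_sinh: "sqrt ((2 * sinh p)\<^sup>2 + 4) = 2 * cosh p" for p :: real
proof -
  have "(2 * sinh p)\<^sup>2 + 4 = (2 * cosh p)\<^sup>2" by (simp add: power_mult_distrib cosh_square_eq)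
  then show ?thesis by (simp only: real_sqrt_abs) simp
qed

text \<open>The momentum \<open>p = arsinh (v / 2)\<close> is the natural variable: in it the kinetic part of the
Lagrangian is the Legendre transform of \<open>2 cosh p - 2\<close>.\<close>

lemma Lagr_sinh: "Lagr V x (2 * sinh p) = - V x + 2 * (p * sinh p - cosh p + 1)"
  unfolding Lagr_arsinh sqrt_sinh by (simp add: arsinh_sinh_real algebra_simps)

lemma kinetic_pos:
  fixes p :: real assumes "p \<noteq> 0" shows "0 < p * sinh p - cosh p + 1"
proof -
  have pos: "0 < q * sinh q - cosh q + 1" if "0 < q" for q :: real
  proof -
    have "0 * sinh 0 - cosh 0 + 1 < q * sinh q - cosh q + 1"
    proof (rule DERIV_pos_imp_increasing_open[OF that])
      fix x :: real assume "0 < x" "x < q"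
      have "((\<lambda>x. x * sinh x - cosh x + 1) has_real_derivative x * cosh x) (at x)"
        by (auto intro!: derivative_eq_intros)
      then show "\<exists>y. ((\<lambda>x. x * sinh x - cosh x + 1) has_real_derivative y) (at x) \<and> 0 < y"
        using \<open>0 < x\<close> by (intro exI[of _ "x * cosh x"]) auto
    qed (auto intro!: continuous_intros)
    then show ?thesis by simp
  qed
  show ?thesis using pos[of p] pos[of "- p"] assms by (cases "0 < p") auto
qed

lemma Lagr_ge: "- V x \<le> Lagr V x v"
  and Lagr_eq_iff: "Lagr V x v = - V x \<longleftrightarrow> v = 0"
proof -
  define p where "p = arsinh (v / 2)"
  have v: "v = 2 * sinh p" by (simp add: p_def)
  show "- V x \<le> Lagr V x v" "Lagr V x v = - V x \<longleftrightarrow> v = 0"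
    unfolding v Lagr_sinh using kinetic_pos[of p] by (cases "p = 0"; simp)+
qed

lemma deriv_Lagr_velocity: "deriv (\<lambda>w. Lagr V x w) v = arsinh (v / 2)"
proof (rule DERIV_imp_deriv)
  have "sqrt ((v / 2)\<^sup>2 + 1) = sqrt ((v\<^sup>2 + 4) / 4)" by (simp add: power_divide field_simps)
  also have "\<dots> = sqrt (v\<^sup>2 + 4) / 2" by (simp add: real_sqrt_divide)
  finally have s: "sqrt ((v / 2)\<^sup>2 + 1) = sqrt (v\<^sup>2 + 4) / 2" .
  have p: "v\<^sup>2 + 4 > 0" by (simp add: add_nonneg_pos)
  have ne: "sqrt (v\<^sup>2 + 4) \<noteq> 0" using p by simp
  show "((\<lambda>w. Lagr V x w) has_field_derivative arsinh (v / 2)) (at v)"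
    unfolding Lagr_arsinh using p ne
    by (auto intro!: derivative_eq_intros DERIV_chain2[OF arsinh_real_has_field_derivative] simp: s)
       (simp add: field_simps)
qed

lemma deriv_Lagr_position:
  assumes "V differentiable (at x)" shows "deriv (\<lambda>y. Lagr V y v) x = - deriv V x"
proof (rule DERIV_imp_deriv)
  have "(V has_real_derivative deriv V x) (at x)"
    using assms by (simp add: DERIV_deriv_iff_real_differentiable)
  then show "((\<lambda>y. Lagr V y v) has_real_derivative - deriv V x) (at x)"
    unfolding Lagr_def by (auto intro!: derivative_eq_intros)
qed

text \<open>The energy \<open>2 cosh p - 2 + V\<close> is conserved and equals \<open>V x0\<close>, so \<open>2 cosh p - 2 = V x0 - V g\<close> is
at most quadratic in \<open>g - x0\<close>. Since \<open>(g')\<^sup>2 = (2 cosh p - 2) (2 cosh p + 2)\<close> with a bounded second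
factor, \<open>g'\<close> grows at most linearly in \<open>g - x0\<close>, and the solution cannot leave \<open>x0\<close>.\<close>

lemma EL_solution_at_max_constant:
  assumes V: "circle_C2 V" and max: "\<And>x. V x \<le> V x0"
    and g: "EL_solution V g" "g 0 = x0" "deriv g 0 = 0"
  shows "g t = x0" "deriv g t = 0"
proof -
  have V': "(V has_real_derivative deriv V x) (at x)" for x
    using V by (auto simp: circle_C2_def DERIV_deriv_iff_real_differentiable)
  have Dg: "(g has_real_derivative deriv g t) (at t)" for t
    using g by (simp add: EL_solution_def DERIV_deriv_iff_real_differentiable)
  define p where "p t = arsinh (deriv g t / 2)" for t
  have vel: "deriv g t = 2 * sinh (p t)" for t by (simp add: p_def)
  have Dp: "(p has_real_derivative - deriv V (g t)) (at t)" for t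
    using g V unfolding EL_solution_def deriv_Lagr_velocity p_def[abs_def]
    by (simp add: deriv_Lagr_position circle_C2_def)
  have "((\<lambda>t. 2 * cosh (p t) + V (g t)) has_real_derivative 0) (at t)" for t
    using vel[of t]
    by (auto intro!: derivative_eq_intros Dp DERIV_chain2[OF V' Dg])
  then have "2 * cosh (p t) + V (g t) = 2 * cosh (p 0) + V (g 0)" for t
    using DERIV_isconst_all[of "\<lambda>t. 2 * cosh (p t) + V (g t)" t 0] by blast
  then have energy: "2 * cosh (p t) - 2 = V x0 - V (g t)" for t
    using g by (simp add: p_def algebra_simps)
  obtain M where M: "M \<ge> 0" "\<And>x. V x0 - V x \<le> M * (x - x0)\<^sup>2"
    using circle_C2_quadratic_max[OF V max] by blast
  obtain xm where xm: "\<And>x. V xm \<le> V x"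
  proof -
    have "continuous_on {0..1} V"
      using V by (auto simp: circle_C2_def intro!: differentiable_imp_continuous_on
          differentiable_at_imp_differentiable_on)
    then obtain z where z: "\<forall>y\<in>{0..1}. V z \<le> V y"
      using continuous_attains_inf[of "{0..1::real}" V] by auto
    have "V z \<le> V x" for x
      using bspec[OF z, of "frac x"] frac_lt_1[of x] frac_ge_0[of x]
      unfolding circle_C2_frac[OF V, of x] by auto
    then show ?thesis by (rule that)
  qed
  define K where "K = 4 + V x0 - V xm"
  have K: "K \<ge> 0" using max[of xm] by (simp add: K_def)
  have bound: "\<bar>deriv g t\<bar> \<le> sqrt (M * K) * \<bar>g t - x0\<bar>" for t
  proof -
    have "(deriv g t)\<^sup>2 = (2 * cosh (p t) - 2) * (2 * cosh (p t) + 2)"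
      
    proof -
      have "(2 * sinh (p t))\<^sup>2 = 4 * (sinh (p t))\<^sup>2" by (simp add: power_mult_distrib)
      also have "\<dots> = 4 * ((cosh (p t))\<^sup>2 - 1)" unfolding sinh_square_eq ..
      also have "\<dots> = (2 * cosh (p t) - 2) * (2 * cosh (p t) + 2)"
        by (simp add: power2_eq_square right_diff_distrib left_diff_distrib distrib_left)
      finally show ?thesis unfolding vel .
    qed
    also have "\<dots> \<le> (M * (g t - x0)\<^sup>2) * K"
      using M(2)[of "g t"] M(1) energy[of t] xm[of "g t"] cosh_real_ge_1[of "p t"]
      by (intro mult_mono) (auto simp: K_def)
    finally have "sqrt ((deriv g t)\<^sup>2) \<le> sqrt (M * K * (g t - x0)\<^sup>2)"
      by (intro real_sqrt_le_mono) (simp add: mult_ac)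
    then show ?thesis by (simp add: real_sqrt_mult)
  qed
  have D: "((\<lambda>t. g t - x0) has_real_derivative deriv g t) (at t)" for t
    by (auto intro!: derivative_eq_intros Dg)
  have "g 0 - x0 = 0" using g(2) by simp
  from linear_growth_imp_zero[OF D bound this] have eq: "g t - x0 = 0" for t .
  then show "g t = x0" by simp
  have "g = (\<lambda>_. x0)" using eq by (auto simp: fun_eq_iff)
  then show "deriv g t = 0" by simp
qed

lemma space_tangent_alg: "space tangent_alg = {0..<1} \<times> UNIV"
  by (simp add: tangent_alg_def space_restrict_space)

lemma to_tangent_flow_measurable:
  assumes "EL_flow V F" shows "(\<lambda>z. to_tangent (F t z)) \<in> tangent_alg \<rightarrow>\<^sub>M tangent_alg"
proof -
  have "continuous_on UNIV (Pair t :: real \<times> real \<Rightarrow> _)" by (intro continuous_intros)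
  then have "continuous_on UNIV (F t)"
    using assms continuous_on_compose2[of UNIV "\<lambda>(t, z). F t z" UNIV "\<lambda>z. (t, z)"]
    by (auto simp: EL_flow_def)
  then have [measurable]: "F t \<in> borel \<rightarrow>\<^sub>M borel \<Otimes>\<^sub>M borel"
    by (simp add: borel_measurable_continuous_onI borel_prod)
  have "(\<lambda>z. (fst (F t z) - real_of_int \<lfloor>fst (F t z)\<rfloor>, snd (F t z))) \<in> borel \<rightarrow>\<^sub>M borel \<Otimes>\<^sub>M borel"
    by measurable
  then have "(\<lambda>z. to_tangent (F t z)) \<in> borel \<rightarrow>\<^sub>M borel"
    by (simp add: to_tangent_def frac_def borel_prod)
  then show ?thesis
    unfolding tangent_alg_def
    by (intro measurable_restrict_space3) (auto simp: to_tangent_def frac_lt_1)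
qed

lemma fst_tangent_measurable: "fst \<in> tangent_alg \<rightarrow>\<^sub>M circle_alg"
proof -
  have "(fst :: real \<times> real \<Rightarrow> real) \<in> borel \<rightarrow>\<^sub>M borel" by (simp flip: borel_prod)
  then show ?thesis unfolding tangent_alg_def circle_alg_def
    by (intro measurable_restrict_space3) auto
qed

lemma dirac_at_max_finite_action:
  assumes V: "circle_C2 V" and F: "EL_flow V F" and x0: "x0 \<in> {0..<1}" and max: "\<And>x. V x \<le> V x0"
  shows "return tangent_alg (x0, 0) \<in> finite_action_probs V F"
    and "action V (return tangent_alg (x0, 0)) = - V x0"
proof -
  let ?m = "return tangent_alg (x0, 0::real)"
  have z0: "(x0, 0) \<in> space tangent_alg" using x0 by (simp add: space_tangent_alg)
  have Vm: "V \<in> borel_measurable borel"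
    using V by (auto simp: circle_C2_def intro!: borel_measurable_continuous_onI
        differentiable_imp_continuous_on differentiable_at_imp_differentiable_on)
  have "(\<lambda>z. Lagr V (fst z) (snd z)) \<in> borel_measurable (borel \<Otimes>\<^sub>M borel)"
    unfolding Lagr_def using Vm by measurable
  then have Lm[measurable]: "(\<lambda>z. Lagr V (fst z) (snd z)) \<in> borel_measurable tangent_alg"
    unfolding tangent_alg_def by (intro measurable_restrict_space1) (simp add: borel_prod)
  have fixed: "F t (x0, 0) = (x0, 0)" for t
  proof -
    define g where "g s = fst (F s (x0, 0))" for s
    have g: "EL_solution V g" "\<And>s. snd (F s (x0, 0)) = deriv g s" "F 0 (x0, 0) = (x0, 0)"
      using F unfolding EL_flow_def g_def[abs_def] by auto
    have "g 0 = x0" "deriv g 0 = 0" using g(2)[of 0] g(3) by (auto simp: g_def)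
    from EL_solution_at_max_constant[OF V max g(1) this] show ?thesis
      using g(2)[of t] by (simp add: g_def prod_eq_iff)
  qed
  have "distr ?m tangent_alg (\<lambda>z. to_tangent (F t z)) = ?m" for t
    using x0 unfolding distr_return[OF to_tangent_flow_measurable[OF F] z0] fixed
    by (simp add: to_tangent_def frac_eq)
  then have inv: "?m \<in> invariant_probs F"
    by (auto simp: invariant_probs_def intro: prob_space_return[OF z0])
  have ae: "AE z in ?m. Lagr V (fst z) (snd z) = - V x0"
    using z0 by (subst AE_return) (auto simp: Lagr_eq_iff)
  interpret prob_space ?m by (rule prob_space_return[OF z0])
  have "integrable ?m (\<lambda>z. Lagr V (fst z) (snd z)) \<longleftrightarrow> integrable ?m (\<lambda>z. - V x0)"
    using Lm ae by (intro integrable_cong_AE) auto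
  then show "?m \<in> finite_action_probs V F" using inv by (simp add: finite_action_probs_def)
  have "action V ?m = (\<integral>z. - V x0 \<partial>?m)"
    unfolding action_def using Lm ae by (intro integral_cong_AE) auto
  also have "\<dots> = - V x0" using prob_space by (simp only: lebesgue_integral_const scaleR_one)
  finally show "action V ?m = - V x0" .
qed

lemma action_ge:
  assumes max: "\<And>x. V x \<le> M" and m: "m \<in> finite_action_probs V F"
  shows "- M \<le> action V m"
proof -
  interpret prob_space m using m by (simp add: finite_action_probs_def invariant_probs_def)
  have "- M = (\<integral>z. - M \<partial>m)" by (simp add: prob_space)
  also have "\<dots> \<le> action V m" unfolding action_def
  proof (rule integral_mono)
    show "- M \<le> Lagr V (fst z) (snd z)" for z
      using Lagr_ge[of V "fst z" "snd z"] max[of "fst z"] by linarith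
  qed (use m in \<open>auto simp: finite_action_probs_def\<close>)
  finally show ?thesis .
qed

lemma min_action_eq:
  assumes V: "circle_C2 V" and F: "EL_flow V F" and x0: "x0 \<in> {0..<1}" and max: "\<And>x. V x \<le> V x0"
  shows "min_action V F = - V x0"
  unfolding min_action_def
proof (rule cInf_eq_minimum)
  show "- V x0 \<in> action V ` finite_action_probs V F"
    using dirac_at_max_finite_action[OF assms] by (metis imageI)
  show "- V x0 \<le> y" if "y \<in> action V ` finite_action_probs V F" for y
    using that by (auto intro: action_ge[OF max])
qed

text \<open>A minimiser has \<open>L + V x0 \<ge> 0\<close> with integral zero, hence \<open>L = - V x0\<close> almost everywhere, and by
\<open>Lagr_ge\<close> this is possible only over a maximum point of \<open>V\<close>.\<close>

lemma mather_measure_unique: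
  assumes V: "circle_C2 V" and F: "EL_flow V F" and x0: "x0 \<in> {0..<1}" and max: "\<And>x. V x \<le> V x0"
    and uniq: "\<And>x. x \<in> {0..<1} \<Longrightarrow> x \<noteq> x0 \<Longrightarrow> V x < V x0"
  shows "is_mather_measure V F nu \<longleftrightarrow> nu = return circle_alg x0"
proof
  have z0: "(x0, 0::real) \<in> space tangent_alg" using x0 by (simp add: space_tangent_alg)
  assume "nu = return circle_alg x0"
  then have "nu = distr (return tangent_alg (x0, 0)) circle_alg fst"
    by (simp add: distr_return[OF fst_tangent_measurable z0])
  then show "is_mather_measure V F nu"
    using dirac_at_max_finite_action[OF V F x0 max] min_action_eq[OF V F x0 max]
    unfolding is_mather_measure_def by (intro bexI[of _ "return tangent_alg (x0, 0)"]) auto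
next
  assume "is_mather_measure V F nu"
  then obtain m where m: "m \<in> finite_action_probs V F" "action V m = - V x0"
    "nu = distr m circle_alg fst"
    using min_action_eq[OF V F x0 max] by (auto simp: is_mather_measure_def)
  let ?L = "\<lambda>z. Lagr V (fst z) (snd z)"
  have sets: "sets m = sets tangent_alg" and int: "integrable m ?L" and prob: "prob_space m"
    using m(1) by (auto simp: finite_action_probs_def invariant_probs_def)
  interpret prob_space m by (rule prob)
  have sp: "space m = {0..<1} \<times> UNIV"
    using sets_eq_imp_space_eq[OF sets] by (simp add: space_tangent_alg)
  have "(\<integral>z. ?L z + V x0 \<partial>m) = 0"
    using m(2) int by (simp add: action_def prob_space)
  moreover have "0 \<le> ?L z + V x0" for z
    using Lagr_ge[of V "fst z" "snd z"] max[of "fst z"] by linarith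
  ultimately have "AE z in m. ?L z + V x0 = 0"
    using int integral_nonneg_eq_0_iff_AE[of m "\<lambda>z. ?L z + V x0"] by simp
  then have "AE z in m. fst z = x0"
  proof (rule AE_mp, intro AE_I2 impI)
    fix z assume z: "z \<in> space m" and "?L z + V x0 = 0"
    then have "V x0 \<le> V (fst z)" using Lagr_ge[of V "fst z" "snd z"] by linarith
    then show "fst z = x0" using uniq[of "fst z"] z sp by force
  qed
  moreover have fm: "fst \<in> m \<rightarrow>\<^sub>M circle_alg"
    using fst_tangent_measurable measurable_cong_sets[OF sets refl] by blast
  moreover have sc: "x0 \<in> space circle_alg" using x0 by (simp add: circle_alg_def space_restrict_space)
  ultimately have "distr m circle_alg fst = distr m circle_alg (\<lambda>_. x0)"
    by (intro distr_cong_AE refl measurable_const)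
  then show "nu = return circle_alg x0" unfolding m(3) distr_const[OF sc] .
qed

section \<open>Exponentials of operators on a finite set\<close>

text \<open>Only the values on \<open>{..<k}\<close> of \<open>Q f\<close> are constrained, as the operators of the chain act on functions on
\<open>nat\<close> of which only these values matter.\<close>

locale finite_op =
  fixes k :: nat and Q :: "(nat \<Rightarrow> real) \<Rightarrow> nat \<Rightarrow> real" and q :: "nat \<Rightarrow> nat \<Rightarrow> real"
  assumes op: "i < k \<Longrightarrow> Q f i = (\<Sum>l<k. q i l * f l)"
begin

definition C :: real where "C = (\<Sum>i<k. \<Sum>l<k. \<bar>q i l\<bar>)"

lemma C_nonneg: "0 \<le> C" by (simp add: C_def sum_nonneg)

lemma row_le_C: "i < k \<Longrightarrow> (\<Sum>l<k. \<bar>q i l\<bar>) \<le> C"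
  unfolding C_def by (rule member_le_sum) (auto simp: sum_nonneg)

lemma op_bound:
  assumes "\<And>i. i < k \<Longrightarrow> \<bar>f i\<bar> \<le> M" "j < k" shows "\<bar>Q f j\<bar> \<le> C * M"
proof -
  have M: "0 \<le> M" using assms(1)[OF assms(2)] by linarith
  have "\<bar>Q f j\<bar> \<le> (\<Sum>l<k. \<bar>q j l\<bar> * M)"
    unfolding op[OF assms(2)] using assms(1)
    by (intro order_trans[OF sum_abs] sum_mono) (auto simp: abs_mult intro!: mult_left_mono)
  also have "\<dots> \<le> C * M"
    using row_le_C[OF assms(2)] M by (simp flip: sum_distrib_right add: mult_right_mono)
  finally show ?thesis .
qed

lemma pow_bound:
  assumes "\<And>i. i < k \<Longrightarrow> \<bar>f i\<bar> \<le> M" "j < k" shows "\<bar>(Q ^^ n) f j\<bar> \<le> C ^ n * M"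
  using assms(2)
proof (induction n arbitrary: j)
  case (Suc n)
  have "\<bar>Q ((Q ^^ n) f) j\<bar> \<le> C * (C ^ n * M)"
    using Suc by (intro op_bound) auto
  then show ?case by (simp add: mult_ac)
qed (use assms(1) in auto)

text \<open>Linearity in the form in which it turns the backward recursion for powers into a forward one.\<close>

lemma pow_expand:
  assumes "i < k" shows "(Q ^^ n) f i = (\<Sum>z<k. f z * (Q ^^ n) (indicator {z}) i)"
  using assms
proof (induction n arbitrary: i)
  case 0
  then have "(\<Sum>z<k. f z * indicator {z} i) = (\<Sum>z<k. if z = i then f i else 0)"
    by (intro sum.cong) (auto simp: indicator_def)
  then show ?case using 0 by simp
next
  case (Suc n)
  have "Q ((Q ^^ n) f) i = (\<Sum>l<k. q i l * (\<Sum>z<k. f z * (Q ^^ n) (indicator {z}) l))"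
    using Suc by (simp add: op)
  also have "\<dots> = (\<Sum>z<k. f z * (\<Sum>l<k. q i l * (Q ^^ n) (indicator {z}) l))"
    unfolding sum_distrib_left by (subst sum.swap) (simp add: mult_ac)
  finally show ?case using Suc.prems by (simp add: op)
qed

lemma exp_summable: "j < k \<Longrightarrow> summable (\<lambda>n. t ^ n / fact n * (Q ^^ n) f j)"
  and exp_abs_le:
    "(\<And>i. i < k \<Longrightarrow> \<bar>f i\<bar> \<le> M) \<Longrightarrow> j < k \<Longrightarrow> \<bar>exp_op Q t f j\<bar> \<le> exp (C * \<bar>t\<bar>) * M"
proof -
  have term_le: "norm (t ^ n / fact n * (Q ^^ n) f j) \<le> inverse (fact n) * (C * \<bar>t\<bar>) ^ n * M"
    if "\<And>i. i < k \<Longrightarrow> \<bar>f i\<bar> \<le> M" "j < k" for n j M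
  proof -
    have "norm (t ^ n / fact n * (Q ^^ n) f j) = \<bar>t\<bar> ^ n / fact n * \<bar>(Q ^^ n) f j\<bar>"
      by (simp add: abs_mult power_abs)
    also have "\<dots> \<le> \<bar>t\<bar> ^ n / fact n * (C ^ n * M)"
      using that by (intro mult_left_mono pow_bound) auto
    finally show ?thesis by (simp add: field_simps)
  qed
  have major: "(\<lambda>n. inverse (fact n) * (C * \<bar>t\<bar>) ^ n * M) sums (exp (C * \<bar>t\<bar>) * M)" for M
    using exp_converges[of "C * \<bar>t\<bar>"] by (intro sums_mult2) (simp add: field_simps)
  show s: "summable (\<lambda>n. t ^ n / fact n * (Q ^^ n) f j)" if "j < k" for j
  proof (rule summable_comparison_test'[of _ 0])
    show "summable (\<lambda>n. inverse (fact n) * (C * \<bar>t\<bar>) ^ n * (\<Sum>i<k. \<bar>f i\<bar>))"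
      using major sums_summable by blast
    show "norm (t ^ n / fact n * (Q ^^ n) f j) \<le> inverse (fact n) * (C * \<bar>t\<bar>) ^ n * (\<Sum>i<k. \<bar>f i\<bar>)" for n
      using that by (intro term_le) (auto intro: member_le_sum)
  qed
  show "\<bar>exp_op Q t f j\<bar> \<le> exp (C * \<bar>t\<bar>) * M" if "\<And>i. i < k \<Longrightarrow> \<bar>f i\<bar> \<le> M" "j < k"
  proof -
    have "norm (exp_op Q t f j) \<le> (\<Sum>n. inverse (fact n) * (C * \<bar>t\<bar>) ^ n * M)"
      unfolding exp_op_def using term_le[OF that] major sums_summable by (intro norm_suminf_le) blast+
    then show ?thesis using sums_unique[OF major] by simp
  qed
qed

lemma exp_0: "exp_op Q 0 f j = f j"
proof -
  have "(\<lambda>n. (Q ^^ n) f j / fact n * 0 ^ n) sums ((Q ^^ 0) f j / fact 0)"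
    by (rule powser_sums_zero)
  then show ?thesis by (simp add: exp_op_def sums_iff mult_ac)
qed

lemma exp_deriv:
  assumes "j < k"
  shows "((\<lambda>t. exp_op Q t f j) has_real_derivative exp_op Q t (Q f) j) (at t)"
proof -
  define c where "c n = (Q ^^ n) f j / fact n" for n
  have "summable (\<lambda>n. c n * x ^ n)" for x
    using exp_summable[OF assms, of x f] by (simp add: c_def mult_ac)
  then have "((\<lambda>t. \<Sum>n. c n * t ^ n) has_real_derivative (\<Sum>n. diffs c n * t ^ n)) (at t)"
    by (rule termdiffs_strong_converges_everywhere)
  moreover have "diffs c n = (Q ^^ n) (Q f) j / fact n" for n
  proof -
    have "(1 + real n) * x / ((1 + real n) * fact n) = x / fact n" for x
      by (rule mult_divide_mult_cancel_left) linarith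
    then show ?thesis by (simp add: diffs_def c_def funpow_swap1)
  qed
  ultimately show ?thesis by (simp add: exp_op_def c_def[abs_def] mult_ac)
qed

lemma exp_commute:
  assumes "j < k" shows "exp_op Q t (Q f) j = Q (exp_op Q t f) j"
proof -
  have "(\<lambda>n. \<Sum>l<k. q j l * (t ^ n / fact n * (Q ^^ n) f l)) sums (\<Sum>l<k. q j l * exp_op Q t f l)"
    unfolding exp_op_def by (intro sums_sum sums_mult summable_sums exp_summable) auto
  moreover have "(\<Sum>l<k. q j l * (t ^ n / fact n * (Q ^^ n) f l)) = t ^ n / fact n * (Q ^^ n) (Q f) j" for n
    unfolding funpow_swap1[symmetric] using assms by (simp add: op sum_distrib_left mult_ac)
  ultimately show ?thesis using assms by (simp add: op sums_iff exp_op_def)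
qed

text \<open>The local error of the exact flow over one step. It is needed uniformly in the starting time
\<open>s\<close>, hence through Taylor's formula along the flow.\<close>

lemma exp_second_order:
  assumes f: "\<And>i. i < k \<Longrightarrow> \<bar>f i\<bar> \<le> M" and j: "j < k" and sh: "0 \<le> s" "0 \<le> h" "s + h \<le> t"
  shows "\<bar>exp_op Q (s + h) f j - exp_op Q s f j - h * Q (exp_op Q s f) j\<bar> \<le> C\<^sup>2 * exp (C * t) * M * h\<^sup>2"
proof (cases "h = 0")
  case False
  define diff where "diff m r = exp_op Q r ((Q ^^ m) f) j" for m r
  have "\<exists>r. s < r \<and> r < s + h \<and>
      diff 0 (s + h) = (\<Sum>m<2. diff m s / fact m * (s + h - s) ^ m) + diff 2 r / fact 2 * (s + h - s) ^ 2"
    using False sh exp_deriv[OF j]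
    by (intro Taylor_up[where a = s and b = "s + h"]) (auto simp: diff_def)
  then obtain r where r: "s < r" "r < s + h"
    and eq: "exp_op Q (s + h) f j = exp_op Q s f j + h * Q (exp_op Q s f) j + diff 2 r / 2 * h\<^sup>2"
    by (auto simp: diff_def numeral_2_eq_2 exp_commute[OF j] mult_ac)
  have M: "0 \<le> M" using f[OF j] by linarith
  have "\<bar>diff 2 r\<bar> \<le> exp (C * \<bar>r\<bar>) * (C ^ 2 * M)"
    unfolding diff_def by (intro exp_abs_le pow_bound f j) auto
  also have "\<dots> \<le> exp (C * t) * (C ^ 2 * M)"
    using r sh C_nonneg M by (intro mult_right_mono) (auto intro!: mult_left_mono)
  finally have "\<bar>diff 2 r / 2\<bar> * h\<^sup>2 \<le> (C\<^sup>2 * exp (C * t) * M) * h\<^sup>2"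
    by (intro mult_right_mono) (auto simp: mult_ac)
  then show ?thesis using eq by (simp add: abs_mult)
qed (use assms(1)[OF j] in simp)

text \<open>Consistency and stability imply convergence. Differentiability of \<open>K\<close> at \<open>0\<close> makes one step of
length \<open>h\<close> agree with the flow up to \<open>e * h\<close> for any \<open>e > 0\<close>, and each step expands by at most
\<open>exp (h * B)\<close>; after \<open>n = t / h\<close> steps the errors add up to a multiple of \<open>e\<close> that is
independent of \<open>n\<close>.\<close>

lemma product_formula:
  fixes K :: "real \<Rightarrow> nat \<Rightarrow> nat \<Rightarrow> real" and Kop :: "real \<Rightarrow> (nat \<Rightarrow> real) \<Rightarrow> nat \<Rightarrow> real"
  assumes Kop: "\<And>h. finite_op k (Kop h) (K h)"
    and K0: "\<And>x y. x < k \<Longrightarrow> y < k \<Longrightarrow> K 0 x y = indicator {y} x"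
    and K': "\<And>x y. x < k \<Longrightarrow> y < k \<Longrightarrow> ((\<lambda>h. K h x y) has_real_derivative q x y) (at 0)"
    and t: "0 \<le> t" and j: "j < k"
  shows "(\<lambda>n. (Kop (t / real n) ^^ n) f j) \<longlonglongrightarrow> exp_op Q t f j"
proof -
  define M where "M = (\<Sum>i<k. \<bar>f i\<bar>)"
  have M: "\<bar>f i\<bar> \<le> M" if "i < k" for i
    unfolding M_def using that by (intro member_le_sum) auto
  have M0: "0 \<le> M" by (simp add: M_def sum_nonneg)
  define Y where "Y = exp (C * t) * M"
  have Y0: "0 \<le> Y" using M0 by (simp add: Y_def)
  define B where "B = C + real k"
  have B0: "0 \<le> B" using C_nonneg by (simp add: B_def)
  define A where "A = real k * Y + C\<^sup>2 * Y"
  have A0: "0 \<le> A" using Y0 by (simp add: A_def)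
  have small: "\<forall>\<^sub>F n in sequentially. \<bar>(Kop (t / real n) ^^ n) f j - exp_op Q t f j\<bar> \<le> t * (A * e) * exp (t * B)"
    if e: "0 < e" "e \<le> 1" for e
  proof -
    \<comment> \<open>the one-step error, as an \<open>o(h)\<close> uniform over the finitely many entries\<close>
    have loc: "\<forall>\<^sub>F h in at 0. \<forall>x<k. \<forall>y<k. \<bar>K h x y - indicator {y} x - h * q x y\<bar> \<le> e * \<bar>h\<bar>"
    proof -
      have "\<forall>\<^sub>F h in at 0. \<bar>K h x y - indicator {y} x - h * q x y\<bar> \<le> e * \<bar>h\<bar>"
        if xy: "x < k" "y < k" for x y
      proof -
        have "((\<lambda>h. (K h x y - K 0 x y) / h) \<longlongrightarrow> q x y) (at 0)"
          using K'[OF xy] by (simp add: DERIV_def)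
        then have "\<forall>\<^sub>F h in at 0. dist ((K h x y - K 0 x y) / h) (q x y) < e"
          using e(1) by (rule tendstoD)
        moreover have "\<forall>\<^sub>F h in at 0. (h::real) \<noteq> 0" by (simp add: eventually_at_filter)
        ultimately show ?thesis
        proof eventually_elim
          case (elim h)
          have "\<bar>K h x y - indicator {y} x - h * q x y\<bar> = \<bar>(K h x y - K 0 x y) / h - q x y\<bar> * \<bar>h\<bar>"
            using elim(2) by (simp flip: abs_mult add: K0[OF xy] left_diff_distrib diff_divide_distrib)
              (simp add: mult.commute)
          then show ?case using elim(1) by (simp add: dist_real_def mult_right_mono)
        qed
      qed
      then have "\<forall>\<^sub>F h in at 0. \<forall>x\<in>{..<k}. \<forall>y\<in>{..<k}. \<bar>K h x y - indicator {y} x - h * q x y\<bar> \<le> e * \<bar>h\<bar>"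
        by (intro eventually_ball_finite ballI) auto
      then show ?thesis by (simp add: Ball_def)
    qed
    then obtain d where d: "0 < d" and Kd: "\<And>h x y. h \<noteq> 0 \<Longrightarrow> \<bar>h\<bar> < d \<Longrightarrow> x < k \<Longrightarrow> y < k \<Longrightarrow>
        \<bar>K h x y - indicator {y} x - h * q x y\<bar> \<le> e * \<bar>h\<bar>"
      unfolding eventually_at by (auto simp: dist_real_def)
    have Kh: "\<bar>K h x y - indicator {y} x - h * q x y\<bar> \<le> e * h" if "0 \<le> h" "h < d" "x < k" "y < k" for h x y
      using Kd[of h x y] K0[of x y] that by (cases "h = 0") auto
    obtain N :: nat where N: "real N > t / min d e" by (metis reals_Archimedean2)
    show ?thesis
    proof (rule eventually_sequentiallyI)
      fix n assume n: "max N 1 \<le> n"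
      define h where "h = t / real n"
      have n0: "real n > 0" using n by simp
      have "t / min d e < real n" using N n by (smt (verit) max.boundedE of_nat_mono)
      moreover have "0 < min d e" using d e by simp
      ultimately have "h < min d e" using n0 by (simp only: h_def pos_divide_less_eq mult.commute)
      then have h: "0 \<le> h" "h < d" "h \<le> e" using t n0 by (auto simp: h_def)
      interpret K: finite_op k "Kop h" "K h" by (rule Kop)
      have step: "\<bar>Kop h g x - g x - h * Q g x\<bar> \<le> real k * (e * h * b)"
        if "\<And>i. i < k \<Longrightarrow> \<bar>g i\<bar> \<le> b" "x < k" for g b x
      proof -
        have "g x = (\<Sum>y<k. indicator {y} x * g y)"
          using that(2) by (simp add: indicator_def if_distrib[of "\<lambda>a. a * _"] cong: if_cong)
        then have "Kop h g x - g x - h * Q g x = (\<Sum>y<k. (K h x y - indicator {y} x - h * q x y) * g y)"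
          using that(2) by (simp add: K.op op left_diff_distrib sum_subtractf sum_distrib_left mult.assoc)
        also have "\<bar>\<dots>\<bar> \<le> (\<Sum>y<k. e * h * b)"
          using Kh[OF h(1,2) that(2)] that(1) e h
          by (intro order_trans[OF sum_abs] sum_mono) (auto simp: abs_mult intro!: mult_mono)
        finally show ?thesis by simp
      qed
      have contr: "\<bar>Kop h g x\<bar> \<le> exp (h * B) * b"
        if "\<And>i. i < k \<Longrightarrow> \<bar>g i\<bar> \<le> b" "x < k" for g b x
      proof -
        have b0: "0 \<le> b" using that(1)[OF that(2)] by linarith
        have "\<bar>Kop h g x\<bar> \<le> \<bar>g x\<bar> + h * \<bar>Q g x\<bar> + real k * (e * h * b)"
        proof -
          have "\<bar>h * Q g x\<bar> = h * \<bar>Q g x\<bar>" using h(1) by (simp add: abs_mult)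
          then show ?thesis using step[of g b x, OF that] by linarith
        qed
        also have "\<dots> \<le> b + h * (C * b) + real k * (1 * h * b)"
          using that op_bound[of g b x, OF that] h e b0 by (intro add_mono mult_left_mono mult_right_mono) auto
        also have "\<dots> = (1 + h * B) * b" by (simp add: B_def algebra_simps)
        also have "\<dots> \<le> exp (h * B) * b" using b0 by (intro mult_right_mono exp_ge_add_one_self)
        finally show ?thesis .
      qed
      \<comment> \<open>\<open>i\<close> local errors of size \<open>A * e * h\<close>, each amplified by at most \<open>i\<close> steps\<close>
      define err where "err i = real i * (A * e * h) * exp (real i * (h * B))" for i
      have err: "\<bar>(Kop h ^^ i) f x - exp_op Q (real i * h) f x\<bar> \<le> err i" if "i \<le> n" "x < k" for i x
        using that
      proof (induction i arbitrary: x)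
        case 0 then show ?case by (simp add: exp_0 err_def)
      next
        case (Suc i)
        let ?y = "exp_op Q (real i * h) f"
        have ih: "real i * h + h \<le> t"
        proof -
          have "(real i + 1) * h \<le> real n * h" using Suc.prems h(1) by (intro mult_right_mono) auto
          moreover have "real n * h = t" using n0 by (simp add: h_def)
          ultimately show ?thesis by (simp only: distrib_right mult_1)
        qed
        have y: "\<bar>?y z\<bar> \<le> Y" if "z < k" for z
        proof -
          have "\<bar>?y z\<bar> \<le> exp (C * \<bar>real i * h\<bar>) * M" by (rule exp_abs_le[OF M that])
          also have "\<dots> \<le> Y" unfolding Y_def using ih h(1) C_nonneg M0
            by (intro mult_right_mono) (auto intro!: mult_left_mono simp: abs_mult)
          finally show ?thesis .
        qed
        have "Kop h ((Kop h ^^ i) f) x - Kop h ?y x = Kop h (\<lambda>z. (Kop h ^^ i) f z - ?y z) x"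
          using Suc.prems by (simp add: K.op right_diff_distrib sum_subtractf)
        then have 1: "\<bar>Kop h ((Kop h ^^ i) f) x - Kop h ?y x\<bar> \<le> exp (h * B) * err i"
          using contr[of "\<lambda>z. (Kop h ^^ i) f z - ?y z" "err i" x] Suc by simp
        have 2: "\<bar>Kop h ?y x - ?y x - h * Q ?y x\<bar> \<le> real k * (e * h * Y)"
          using step[of ?y Y x] y Suc.prems by simp
        have "\<bar>exp_op Q (real i * h + h) f x - ?y x - h * Q ?y x\<bar> \<le> C\<^sup>2 * exp (C * t) * M * h\<^sup>2"
          using Suc.prems h ih by (intro exp_second_order M) auto
        also have "\<dots> \<le> C\<^sup>2 * Y * (e * h)"
          unfolding Y_def power2_eq_square[of h] using h M0
          by (auto simp: mult.assoc intro!: mult_left_mono mult_right_mono)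
        finally have 3: "\<bar>exp_op Q (real i * h + h) f x - ?y x - h * Q ?y x\<bar> \<le> C\<^sup>2 * Y * (e * h)" .
        have "\<bar>Kop h ((Kop h ^^ i) f) x - exp_op Q (real i * h + h) f x\<bar> \<le> exp (h * B) * err i + A * e * h"
        proof -
          have "A * e * h = real k * (e * h * Y) + C\<^sup>2 * Y * (e * h)"
            by (simp add: A_def algebra_simps)
          then show ?thesis using 1 2 3 by linarith
        qed
        also have "A * e * h \<le> A * e * h * exp (real (Suc i) * (h * B))"
        proof -
          have "0 \<le> A * e * h" "0 \<le> real (Suc i) * (h * B)" using A0 e h B0 by simp_all
          then show ?thesis
            using mult_left_mono[of 1 "exp (real (Suc i) * (h * B))" "A * e * h"] by simp
        qed
        also have "exp (h * B) * err i + \<dots> = err (Suc i)"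
          by (simp add: err_def exp_add distrib_left distrib_right mult_ac)
        finally show ?case by (simp add: distrib_right add.commute)
      qed
      have nh: "real n * h = t" using n0 by (simp add: h_def)
      have "err n = (real n * h) * (A * e) * exp ((real n * h) * B)"
        by (simp only: err_def mult.assoc mult.commute mult.left_commute)
      then have "err n = t * (A * e) * exp (t * B)" unfolding nh .
      then show "\<bar>(Kop (t / real n) ^^ n) f j - exp_op Q t f j\<bar> \<le> t * (A * e) * exp (t * B)"
        using err[OF order_refl j] unfolding nh unfolding h_def by simp
    qed
  qed
  show ?thesis
  proof (rule tendstoI)
    fix r :: real assume r: "0 < r"
    define D where "D = t * A * exp (t * B) + 1"
    have D: "0 < D" using t A0 by (simp add: D_def add_nonneg_pos)
    define e where "e = min 1 (r / (2 * D))"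
    have e: "0 < e" "e \<le> 1" "e \<le> r / (2 * D)" using r D by (auto simp: e_def)
    have "t * (A * e) * exp (t * B) \<le> D * e" using e by (simp add: D_def distrib_right mult_ac)
    also have "\<dots> \<le> D * (r / (2 * D))" using D e by (intro mult_left_mono) auto
    also have "\<dots> < r" using D r by simp
    finally have "t * (A * e) * exp (t * B) < r" .
    then show "\<forall>\<^sub>F n in sequentially. dist ((Kop (t / real n) ^^ n) f j) (exp_op Q t f j) < r"
      using small[OF e(1,2)] by (auto simp: dist_real_def elim!: eventually_mono)
  qed
qed

end

section \<open>Events and expectations on path space\<close>

lemma space_path_past: "space (path_past k T) = cadlag_paths k"
  and sets_path_past: "sets (path_past k T) = sigma_sets (cadlag_paths k)
        {{\<omega> \<in> cadlag_paths k. \<omega> t \<in> B} | t B. 0 \<le> t \<and> t \<le> T \<and> B \<subseteq> {..<k}}"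
  unfolding path_past_def by (auto intro!: space_measure_of sets_measure_of)

lemma sets_path_algebra: "sets (path_algebra k) = sigma_sets (cadlag_paths k)
        {{\<omega> \<in> cadlag_paths k. \<omega> t \<in> B} | t B. 0 \<le> t \<and> B \<subseteq> {..<k}}"
  unfolding path_algebra_def by (auto intro!: sets_measure_of)

lemma sets_path_past_subset: "sets (path_past k T) \<subseteq> sets (path_algebra k)"
  unfolding sets_path_past sets_path_algebra by (rule sigma_sets_mono') blast

lemma path_in_states: "\<omega> \<in> cadlag_paths k \<Longrightarrow> 0 \<le> t \<Longrightarrow> \<omega> t < k"
  by (auto simp: cadlag_paths_def PiE_def Pi_def)

lemma path_past_coordinate_measurable:
  assumes "0 \<le> t" "t \<le> T"
  shows "(\<lambda>\<omega>. \<omega> t) \<in> path_past k T \<rightarrow>\<^sub>M count_space UNIV"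
proof (rule measurableI)
  fix B :: "nat set"
  have "(\<lambda>\<omega>. \<omega> t) -` B \<inter> space (path_past k T) = {\<omega> \<in> cadlag_paths k. \<omega> t \<in> B \<inter> {..<k}}"
    using path_in_states[of _ k t] assms by (auto simp: space_path_past)
  also have "\<dots> \<in> sets (path_past k T)"
    unfolding sets_path_past using assms by (intro sigma_sets.Basic) blast
  finally show "(\<lambda>\<omega>. \<omega> t) -` B \<inter> space (path_past k T) \<in> sets (path_past k T)" .
qed simp

lemma path_right_constant:
  assumes "\<omega> \<in> cadlag_paths k" "0 \<le> s"
  shows "\<exists>b>s. \<forall>r. s \<le> r \<longrightarrow> r < b \<longrightarrow> \<omega> r = \<omega> s"
proof -
  have "(\<omega> \<longlongrightarrow> \<omega> s) (at_right s)" using assms by (simp add: cadlag_paths_def)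
  then have "\<forall>\<^sub>F r in at_right s. \<omega> r \<in> {\<omega> s}"
    by (rule topological_tendstoD) (simp_all add: Topological_Spaces.open_discrete)
  then obtain b where b: "s < b" "\<forall>r>s. r < b \<longrightarrow> \<omega> r = \<omega> s"
    unfolding eventually_at_right_field by auto
  have "\<omega> r = \<omega> s" if "s \<le> r" "r < b" for r
    using b(2) that by (cases "r = s") auto
  then show ?thesis using b(1) by blast
qed

lemma dyadic_mesh_small:
  fixes T e :: real assumes "0 < e" "0 \<le> T"
  obtains N0 where "\<And>N. N0 \<le> N \<Longrightarrow> T / 2 ^ N < e"
proof -
  have "(\<lambda>N. T * (1 / 2) ^ N) \<longlonglongrightarrow> T * 0"
    by (intro tendsto_mult tendsto_const LIMSEQ_power_zero) simp
  then have "\<forall>\<^sub>F N in sequentially. T * (1 / 2) ^ N < e"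
    using assms by (intro order_tendstoD) auto
  then show ?thesis using that unfolding eventually_sequentially by (auto simp: power_divide)
qed

definition dyadic_cyl :: "nat \<Rightarrow> real \<Rightarrow> nat \<Rightarrow> (nat \<Rightarrow> nat) \<Rightarrow> (real \<Rightarrow> nat) set" where
  "dyadic_cyl k T m x = {\<omega> \<in> cadlag_paths k. \<forall>i\<le>2 ^ m. \<omega> (real i * (T / 2 ^ m)) = x i}"

lemma dyadic_refine: "m \<le> n \<Longrightarrow> real (i * 2 ^ (n - m)) * (T / 2 ^ n) = real i * (T / 2 ^ m)"
proof -
  assume "m \<le> n"
  then have "(2::real) ^ n = 2 ^ (n - m) * 2 ^ m" by (simp flip: power_add)
  then show ?thesis by simp
qed

lemma dyadic_time_bounds:
  assumes "0 \<le> T" "i \<le> 2 ^ m"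
  shows "0 \<le> real i * (T / 2 ^ m)" "real i * (T / 2 ^ m) \<le> T"
proof -
  have "real i \<le> 2 ^ m" using assms(2) by (metis of_nat_le_iff of_nat_numeral of_nat_power)
  then have "real i * (T / 2 ^ m) \<le> 2 ^ m * (T / 2 ^ m)" using assms by (intro mult_right_mono) auto
  then show "0 \<le> real i * (T / 2 ^ m)" "real i * (T / 2 ^ m) \<le> T" using assms by auto
qed

text \<open>Dyadic meshes are nested, so of two cylinders the one on the finer mesh is either contained in
the other or disjoint from it.\<close>

lemma Int_stable_dyadic_cyl:
  assumes T: "0 \<le> T" shows "Int_stable (range (\<lambda>(m, x). dyadic_cyl k T m x))"
proof -
  let ?G = "range (\<lambda>(m, x). dyadic_cyl k T m x)"
  have mem: "dyadic_cyl k T m x \<in> ?G" for m x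
    by (rule range_eqI[of _ _ "(m, x)"]) simp
  have empty: "{} \<in> ?G"
  proof -
    have "\<omega> \<notin> dyadic_cyl k T 0 (\<lambda>_. k)" for \<omega>
    proof
      assume "\<omega> \<in> dyadic_cyl k T 0 (\<lambda>_. k)"
      then have "\<omega> \<in> cadlag_paths k" "\<omega> (real 0 * (T / 2 ^ 0)) = k"
        unfolding dyadic_cyl_def by blast+
      then show False using path_in_states[of \<omega> k 0] by simp
    qed
    then have "dyadic_cyl k T 0 (\<lambda>_. k) = {}" by blast
    then show ?thesis using mem[of 0 "\<lambda>_. k"] by simp
  qed
  have "dyadic_cyl k T m x \<inter> dyadic_cyl k T n y \<in> ?G" if mn: "m \<le> n" for m n x y
  proof (cases "\<forall>i\<le>2 ^ m. x i = y (i * 2 ^ (n - m))")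
    case True
    have "dyadic_cyl k T n y \<subseteq> dyadic_cyl k T m x"
    proof
      fix \<omega> assume w: "\<omega> \<in> dyadic_cyl k T n y"
      have "\<omega> (real i * (T / 2 ^ m)) = x i" if i: "i \<le> 2 ^ m" for i
      proof -
        have "i * 2 ^ (n - m) \<le> 2 ^ m * 2 ^ (n - m)" using i by simp
        also have "(2::nat) ^ m * 2 ^ (n - m) = 2 ^ n" using mn by (simp flip: power_add)
        finally have "\<omega> (real (i * 2 ^ (n - m)) * (T / 2 ^ n)) = y (i * 2 ^ (n - m))"
          using w unfolding dyadic_cyl_def by blast
        then show ?thesis unfolding dyadic_refine[OF mn] using True[rule_format, OF i] by (simp only:)
      qed
      moreover have "\<omega> \<in> cadlag_paths k" using w unfolding dyadic_cyl_def by blast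
      ultimately show "\<omega> \<in> dyadic_cyl k T m x" unfolding dyadic_cyl_def by blast
    qed
    then have "dyadic_cyl k T m x \<inter> dyadic_cyl k T n y = dyadic_cyl k T n y" by blast
    then show ?thesis using mem by (simp only:)
  next
    case False
    then obtain i where i: "i \<le> 2 ^ m" "x i \<noteq> y (i * 2 ^ (n - m))" by blast
    have "i * 2 ^ (n - m) \<le> 2 ^ m * 2 ^ (n - m)" using i by simp
    also have "(2::nat) ^ m * 2 ^ (n - m) = 2 ^ n" using mn by (simp flip: power_add)
    finally have le: "i * 2 ^ (n - m) \<le> 2 ^ n" .
    have "\<omega> (real i * (T / 2 ^ m)) = y (i * 2 ^ (n - m))" if "\<omega> \<in> dyadic_cyl k T n y" for \<omega>
    proof -
      have "\<omega> (real (i * 2 ^ (n - m)) * (T / 2 ^ n)) = y (i * 2 ^ (n - m))"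
        using that le unfolding dyadic_cyl_def by blast
      then show ?thesis unfolding dyadic_refine[OF mn] .
    qed
    moreover have "\<omega> (real i * (T / 2 ^ m)) = x i" if "\<omega> \<in> dyadic_cyl k T m x" for \<omega>
      using that i(1) unfolding dyadic_cyl_def by blast
    ultimately have "dyadic_cyl k T m x \<inter> dyadic_cyl k T n y = {}" using i(2) by force
    then show ?thesis using empty by (simp only:)
  qed
  note * = this
  have "dyadic_cyl k T m x \<inter> dyadic_cyl k T n y \<in> ?G" for m n x y
  proof (cases "m \<le> n")
    case True then show ?thesis by (rule *)
  next
    case False
    then have "dyadic_cyl k T n y \<inter> dyadic_cyl k T m x \<in> ?G" by (intro *) simp
    then show ?thesis by (simp only: Int_commute)
  qed
  then show ?thesis unfolding Int_stable_def by (auto simp only: split_paired_all prod.case)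
qed

lemma coordinate_set_measurable:
  assumes "(\<lambda>\<omega>. \<omega> t) \<in> M \<rightarrow>\<^sub>M count_space UNIV"
  shows "{\<omega> \<in> space M. \<omega> t = y} \<in> sets M"
proof -
  have "(\<lambda>\<omega>. \<omega> t) -` {y} \<inter> space M = {\<omega> \<in> space M. \<omega> t = y}" by blast
  then show ?thesis using measurable_sets[OF assms, of "{y}"] by simp
qed

lemma dyadic_cyl_in_path_past:
  assumes "0 \<le> T" shows "dyadic_cyl k T m x \<in> sets (path_past k T)"
proof -
  have "{\<omega> \<in> space (path_past k T). \<forall>i\<in>{..2 ^ m}. \<omega> (real i * (T / 2 ^ m)) = x i} \<in> sets (path_past k T)"
  proof (rule sets.sets_Collect_finite_All)
    fix i assume "i \<in> {..(2::nat) ^ m}"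
    then show "{\<omega> \<in> space (path_past k T). \<omega> (real i * (T / 2 ^ m)) = x i} \<in> sets (path_past k T)"
      using assms
      by (intro coordinate_set_measurable path_past_coordinate_measurable dyadic_time_bounds) simp_all
  qed simp
  then show ?thesis unfolding dyadic_cyl_def space_path_past Ball_def atMost_iff .
qed

text \<open>The state at time \<open>t\<close> is the eventual value along the dyadic times that decrease to \<open>t\<close>.
Rounding up keeps these times in \<open>[0, T]\<close> even for \<open>t = T\<close>.\<close>

lemma sets_path_past_dyadic:
  assumes T: "0 \<le> T"
  shows "sets (path_past k T) = sigma_sets (cadlag_paths k) (range (\<lambda>(m, x). dyadic_cyl k T m x))"
    (is "_ = sigma_sets ?\<Omega> ?G")
proof
  have "?G \<subseteq> sets (path_past k T)" using dyadic_cyl_in_path_past[OF T] by auto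
  then show "sigma_sets ?\<Omega> ?G \<subseteq> sets (path_past k T)"
    using sets.sigma_sets_subset[of ?G "path_past k T"] by (simp add: space_path_past)
next
  define M where "M = sigma ?\<Omega> ?G"
  have GP: "?G \<subseteq> Pow ?\<Omega>" by (auto simp: dyadic_cyl_def)
  have sM: "space M = ?\<Omega>" "sets M = sigma_sets ?\<Omega> ?G"
    using GP by (auto simp: M_def)
  have cyl: "dyadic_cyl k T m x \<in> sets M" for m x
    unfolding sM by (intro sigma_sets.Basic) auto
  have dyadic: "{\<omega> \<in> space M. \<omega> (real i * (T / 2 ^ m)) \<in> B} \<in> sets M" if i: "i \<le> 2 ^ m" for i m B
  proof -
    define X where "X = {x \<in> {..2 ^ m} \<rightarrow>\<^sub>E {..<k}. x i \<in> B}"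
    have "finite X" unfolding X_def by (intro finite_subset[OF _ finite_PiE[of "{..2 ^ m}" "\<lambda>_. {..<k}"]]) auto
    then have "(\<Union>x\<in>X. dyadic_cyl k T m x) \<in> sets M" using cyl by (intro sets.finite_UN) auto
    moreover have "(\<Union>x\<in>X. dyadic_cyl k T m x) = {\<omega> \<in> space M. \<omega> (real i * (T / 2 ^ m)) \<in> B}"
    proof (intro equalityI subsetI)
      fix \<omega> assume w: "\<omega> \<in> {\<omega> \<in> space M. \<omega> (real i * (T / 2 ^ m)) \<in> B}"
      define x where "x = (\<lambda>j\<in>{..2 ^ m}. \<omega> (real j * (T / 2 ^ m)))"
      have "x \<in> X" using w i path_in_states dyadic_time_bounds[OF T] by (auto simp: X_def x_def sM)
      moreover have "\<omega> \<in> dyadic_cyl k T m x" using w by (auto simp: dyadic_cyl_def x_def sM)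
      ultimately show "\<omega> \<in> (\<Union>x\<in>X. dyadic_cyl k T m x)" by blast
    next
      fix \<omega> assume "\<omega> \<in> (\<Union>x\<in>X. dyadic_cyl k T m x)"
      then show "\<omega> \<in> {\<omega> \<in> space M. \<omega> (real i * (T / 2 ^ m)) \<in> B}"
        using i by (auto simp: X_def dyadic_cyl_def sM)
    qed
    ultimately show ?thesis by simp
  qed
  have "{\<omega> \<in> ?\<Omega>. \<omega> t \<in> B} \<in> sets M" if t: "0 \<le> t" "t \<le> T" for t B
  proof (cases "T = 0")
    case True
    then show ?thesis using dyadic[of 0 0 B] t by (simp add: sM)
  next
    case False
    then have T0: "0 < T" using T by simp
    define i where "i N = nat \<lceil>t * 2 ^ N / T\<rceil>" for N
    have ri: "real (i N) = of_int \<lceil>t * 2 ^ N / T\<rceil>" for N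
      using t T0 unfolding i_def by (simp add: ceiling_le_zero zero_le_ceiling less_le_trans[of "-1" 0])
    have lower: "t \<le> real (i N) * (T / 2 ^ N)" for N
    proof -
      have "t * 2 ^ N / T \<le> real (i N)" unfolding ri by (rule le_of_int_ceiling)
      then show ?thesis using T0 by (simp add: field_simps)
    qed
    have upper: "real (i N) * (T / 2 ^ N) < t + T / 2 ^ N" for N
    proof -
      have "real (i N) < t * 2 ^ N / T + 1" unfolding ri using ceiling_correct[of "t * 2 ^ N / T"] by linarith
      then show ?thesis using T0 by (simp add: field_simps)
    qed
    have bound: "i N \<le> 2 ^ N" for N
    proof -
      have "t * 2 ^ N / T \<le> of_int (2 ^ N)" using t T0 by (simp add: field_simps)
      then have "\<lceil>t * 2 ^ N / T\<rceil> \<le> 2 ^ N" unfolding ceiling_le_iff .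
      then show ?thesis unfolding i_def by (simp add: nat_le_iff)
    qed
    have 1: "{\<omega> \<in> space M. \<exists>N0. \<forall>N\<ge>N0. \<omega> (real (i N) * (T / 2 ^ N)) \<in> B} \<in> sets M"
      by (intro sets.sets_Collect dyadic bound)
    have iff: "(\<exists>N0. \<forall>N\<ge>N0. \<omega> (real (i N) * (T / 2 ^ N)) \<in> B) \<longleftrightarrow> \<omega> t \<in> B" if w: "\<omega> \<in> ?\<Omega>" for \<omega>
    proof -
      obtain b where b: "t < b" "\<forall>r. t \<le> r \<longrightarrow> r < b \<longrightarrow> \<omega> r = \<omega> t"
        using path_right_constant[OF w t(1)] by blast
      obtain N1 where N1: "\<And>N. N1 \<le> N \<Longrightarrow> T / 2 ^ N < b - t"
        using dyadic_mesh_small[of "b - t" T] b(1) T by auto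
      have ev: "\<omega> (real (i N) * (T / 2 ^ N)) = \<omega> t" if "N1 \<le> N" for N
        using N1[OF that] lower[of N] upper[of N] by (intro b(2)[rule_format]) auto
      show ?thesis
      proof
        assume "\<exists>N0. \<forall>N\<ge>N0. \<omega> (real (i N) * (T / 2 ^ N)) \<in> B"
        then obtain N0 where "\<forall>N\<ge>N0. \<omega> (real (i N) * (T / 2 ^ N)) \<in> B" by blast
        from this[rule_format, of "max N0 N1"] show "\<omega> t \<in> B" using ev[of "max N0 N1"] by simp
      next
        assume "\<omega> t \<in> B"
        then show "\<exists>N0. \<forall>N\<ge>N0. \<omega> (real (i N) * (T / 2 ^ N)) \<in> B"
          using ev by (intro exI[of _ N1]) auto
      qed
    qed
    have 2: "{\<omega> \<in> ?\<Omega>. \<exists>N0. \<forall>N\<ge>N0. \<omega> (real (i N) * (T / 2 ^ N)) \<in> B} = {\<omega> \<in> ?\<Omega>. \<omega> t \<in> B}"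
      by (intro Collect_cong conj_cong refl iff)
    show ?thesis using 1 unfolding sM(1) 2 .
  qed
  then have gen: "{{\<omega> \<in> ?\<Omega>. \<omega> t \<in> B} |t B. 0 \<le> t \<and> t \<le> T \<and> B \<subseteq> {..<k}} \<subseteq> sets M"
    by (intro subsetI) (elim CollectE exE conjE, simp only:)
  from sets.sigma_sets_subset[OF gen] show "sets (path_past k T) \<subseteq> sigma_sets ?\<Omega> ?G"
    unfolding sets_path_past sM .
qed

text \<open>The sum is the integral of a step function that on each mesh interval takes the value at the right
end point. By right continuity these step functions converge at every \<open>s\<close>, so
dominated convergence applies.\<close>

lemma right_riemann_sums_tendsto:
  fixes c :: "nat \<Rightarrow> real"
  assumes w: "\<omega> \<in> cadlag_paths k" and T: "0 \<le> T"
  shows "(\<lambda>N. \<Sum>j<2 ^ N. T / 2 ^ N * c (\<omega> (real (Suc j) * (T / 2 ^ N))))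
           \<longlonglongrightarrow> (\<integral>s. indicator {0<..T} s * c (\<omega> s) \<partial>lborel)"
proof -
  define I where "I N j = {real j * (T / 2 ^ N)<..real (Suc j) * (T / 2 ^ N)}" for N j
  define f where "f N s = (\<Sum>j<2 ^ N. c (\<omega> (real (Suc j) * (T / 2 ^ N))) * indicator (I N j) s)" for N s
  define Cm where "Cm = (\<Sum>i<k. \<bar>c i\<bar>)"
  have Cm: "\<bar>c i\<bar> \<le> Cm" if "i < k" for i unfolding Cm_def using that by (intro member_le_sum) auto
  have part: "(\<Sum>j<n. indicator (I N j) s) = (indicator {0<..real n * (T / 2 ^ N)} s :: real)" for n N s
  proof (induction n)
    case (Suc n)
    have "0 \<le> real n * (T / 2 ^ N)" using T by simp
    moreover have "real n * (T / 2 ^ N) \<le> real (Suc n) * (T / 2 ^ N)"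
      by (rule mult_right_mono) (use T in auto)
    ultimately show ?case unfolding sum.lessThan_Suc Suc by (auto simp: I_def indicator_def)
  qed simp
  then have part2: "(\<Sum>j<2 ^ N. indicator (I N j) s) = (indicator {0<..T} s :: real)" for N s
    using part[of N s "2 ^ N"] by simp
  have f_le: "\<bar>f N s\<bar> \<le> Cm * indicator {0<..T} s" for N s
  proof -
    have "\<bar>f N s\<bar> \<le> (\<Sum>j<2 ^ N. Cm * indicator (I N j) s)"
      unfolding f_def using path_in_states[OF w] T
      by (intro order_trans[OF sum_abs] sum_mono) (auto simp: abs_mult intro!: mult_right_mono Cm)
    then show ?thesis by (simp only: sum_distrib_left[symmetric] part2)
  qed
  have lim: "(\<lambda>N. f N s) \<longlonglongrightarrow> indicator {0<..T} s * c (\<omega> s)" for s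
  proof (cases "s \<in> {0<..T}")
    case True
    then have "0 \<le> s" by simp
    then obtain b where b: "s < b" "\<forall>r. s \<le> r \<longrightarrow> r < b \<longrightarrow> \<omega> r = \<omega> s"
      using path_right_constant[OF w] by blast
    obtain N1 where N1: "\<And>N. N1 \<le> N \<Longrightarrow> T / 2 ^ N < b - s"
      using dyadic_mesh_small[of "b - s" T] b(1) T by auto
    have "f N s = indicator {0<..T} s * c (\<omega> s)" if N: "N1 \<le> N" for N
    proof -
      have eq: "c (\<omega> (real (Suc j) * (T / 2 ^ N))) * indicator (I N j) s = c (\<omega> s) * indicator (I N j) s" for j
      proof (cases "s \<in> I N j")
        case True
        then have s: "real j * (T / 2 ^ N) < s" "s \<le> real (Suc j) * (T / 2 ^ N)"
          unfolding I_def by simp_all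
        have "real (Suc j) * d = real j * d + d" for d :: real by (simp add: distrib_right)
        from this[of "T / 2 ^ N"] have "real (Suc j) * (T / 2 ^ N) < b"
          using N1[OF N] s by linarith
        then have "\<omega> (real (Suc j) * (T / 2 ^ N)) = \<omega> s" using b(2) s(2) by blast
        then show ?thesis by (simp only:)
      qed simp
      have "f N s = (\<Sum>j<2 ^ N. c (\<omega> s) * indicator (I N j) s)"
        unfolding f_def by (rule sum.cong[OF refl eq])
      also have "\<dots> = c (\<omega> s) * indicator {0<..T} s"
        by (simp only: sum_distrib_left[symmetric] part2)
      finally show ?thesis by (simp only: mult.commute)
    qed
    then show ?thesis by (intro tendsto_eventually eventually_sequentiallyI) auto
  next
    case False
    then have "f N s = 0" for N using f_le[of N s] by simp
    then show ?thesis using False by simp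
  qed
  have fm[measurable]: "f N \<in> borel_measurable lborel" for N
    unfolding f_def[abs_def] I_def by measurable
  have gm: "(\<lambda>s. indicator {0<..T} s * c (\<omega> s)) \<in> borel_measurable lborel"
    using lim fm by (rule borel_measurable_LIMSEQ_real)
  have int: "integrable lborel (\<lambda>s. Cm * indicator {0<..T} s)"
    using T by (intro integrable_mult_right integrable_real_indicator) auto
  have "(\<lambda>N. \<integral>s. f N s \<partial>lborel) \<longlonglongrightarrow> (\<integral>s. indicator {0<..T} s * c (\<omega> s) \<partial>lborel)"
    using f_le lim by (intro integral_dominated_convergence[OF gm fm int]) auto
  moreover have "(\<integral>s. f N s \<partial>lborel) = (\<Sum>j<2 ^ N. T / 2 ^ N * c (\<omega> (real (Suc j) * (T / 2 ^ N))))" for N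
  proof -
    have inc: "real (Suc j) * e - real j * e = e" for j and e :: real by (simp add: algebra_simps)
    have le: "real j * (T / 2 ^ N) \<le> real (Suc j) * (T / 2 ^ N)" for j
      by (rule mult_right_mono) (use T in auto)
    have "has_bochner_integral lborel (f N) (\<Sum>j<2 ^ N. c (\<omega> (real (Suc j) * (T / 2 ^ N))) * (T / 2 ^ N))"
      unfolding f_def[abs_def]
    proof (intro has_bochner_integral_sum has_bochner_integral_mult_right)
      fix j
      have "has_bochner_integral lborel (indicator (I N j)) (measure lborel (I N j))"
        unfolding I_def using le[of j] by (intro has_bochner_integral_real_indicator) auto
      moreover have "measure lborel (I N j) = T / 2 ^ N"
        unfolding I_def measure_lborel_Ioc[OF le] by (rule inc)
      ultimately show "has_bochner_integral lborel (indicator (I N j)) (T / 2 ^ N)" by simp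
    qed
    then show ?thesis by (simp add: has_bochner_integral_integral_eq mult.commute)
  qed
  ultimately show ?thesis by simp
qed

text \<open>The row vector \<open>a\<close> times the product of the first \<open>i\<close> of the \<open>k \<times> k\<close> matrices \<open>W 0, W 1, ...\<close>.\<close>

primrec fwd :: "nat \<Rightarrow> (nat \<Rightarrow> real) \<Rightarrow> (nat \<Rightarrow> nat \<Rightarrow> nat \<Rightarrow> real) \<Rightarrow> nat \<Rightarrow> nat \<Rightarrow> real" where
  "fwd k a W 0 y = a y"
| "fwd k a W (Suc i) y = (\<Sum>x<k. fwd k a W i x * W i x y)"

lemma chain_uniform_cylinder:
  assumes law: "chain_law k Q nu P" and d: "0 \<le> d" and x: "\<forall>i\<le>n. x i < k"
  shows "measure P {\<omega> \<in> space P. \<forall>i\<le>n. \<omega> (real i * d) = x i}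
       = nu (x 0) * (\<Prod>i<n. exp_op Q d (indicator {x (Suc i)}) (x i))"
proof -
  have fdd: "measure P {\<omega> \<in> space P. \<forall>i\<le>n. \<omega> (t i) = x i} =
        nu (x 0) * (\<Prod>i<n. exp_op Q (t (Suc i) - t i) (indicator {x (Suc i)}) (x i))"
    if "t 0 = 0" "\<forall>i<n. t i \<le> t (Suc i)" for t :: "nat \<Rightarrow> real"
    using law that x unfolding chain_law_def by blast
  have inc: "real (Suc i) * d - real i * d = d" for i by (simp add: algebra_simps)
  have "\<forall>i<n. real i * d \<le> real (Suc i) * d" using inc d by (metis diff_ge_0_iff_ge)
  from fdd[of "\<lambda>i. real i * d", OF _ this] show ?thesis unfolding inc by simp
qed

text \<open>The expectation of a product of edge weights is computed by the forward recursion \<open>fwd\<close>. The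
induction on the number \<open>r\<close> of weights already present strengthens the claim by prescribing the path at all
the later times \<open>r, ..., n\<close>; for \<open>r = 0\<close> this is the finite-dimensional distribution, and passing
from \<open>r\<close> to \<open>r + 1\<close> sums over the state at time \<open>r\<close>.\<close>

lemma chain_path_integral:
  fixes h :: "nat \<Rightarrow> real" and w :: "nat \<Rightarrow> nat \<Rightarrow> nat \<Rightarrow> real"
  assumes law: "chain_law k Q nu P" and d: "0 \<le> d"
  shows "has_bochner_integral P (\<lambda>\<omega>. h (\<omega> 0) * (\<Prod>i<n. w i (\<omega> (real i * d)) (\<omega> (real (Suc i) * d))))
     (\<Sum>y<k. fwd k (\<lambda>y. nu y * h y) (\<lambda>i x y. exp_op Q d (indicator {y}) x * w i x y) n y)"
proof -
  interpret prob_space P using law by (simp add: chain_law_def)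
  have sp: "space P = cadlag_paths k" and sts: "sets P = sets (path_algebra k)"
    using law by (auto simp: chain_law_def)
  have pos: "0 \<le> real i * d" for i using d by simp
  have st: "\<omega> (real i * d) < k" if "\<omega> \<in> space P" for \<omega> i
    using path_in_states[OF _ pos] that sp by simp
  let ?p = "\<lambda>x y. exp_op Q d (indicator {y}) x"
  let ?F = "fwd k (\<lambda>y. nu y * h y) (\<lambda>i x y. ?p x y * w i x y)"
  let ?cyl = "\<lambda>r x. {\<omega> \<in> space P. \<forall>i\<in>{r..n}. \<omega> (real i * d) = x i}"
  let ?f = "\<lambda>r \<omega>. h (\<omega> 0) * (\<Prod>i<r. w i (\<omega> (real i * d)) (\<omega> (real (Suc i) * d)))"
  have main: "has_bochner_integral P (\<lambda>\<omega>. ?f r \<omega> * indicator (?cyl r x) \<omega>)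
      (?F r (x r) * (\<Prod>i\<in>{r..<n}. ?p (x i) (x (Suc i))))"
    if "r \<le> n" "\<And>i. i \<le> n \<Longrightarrow> x i < k" for r x
    using that
  proof (induction r arbitrary: x)
    case 0
    have ms: "?cyl 0 x \<in> sets P"
    proof -
      have "(\<lambda>\<omega>. \<omega> (real i * d)) \<in> P \<rightarrow>\<^sub>M count_space UNIV" for i
      proof -
        have "(\<lambda>\<omega>. \<omega> (real i * d)) \<in> path_past k (real i * d) \<rightarrow>\<^sub>M count_space UNIV"
          using pos by (intro path_past_coordinate_measurable) auto
        then show ?thesis using sets_path_past_subset[of k "real i * d"] sp sts
          by (auto simp: measurable_def space_path_past)
      qed
      then show ?thesis by (intro sets.sets_Collect_finite_All coordinate_set_measurable) simp_all
    qed
    have meas: "measure P (?cyl 0 x) = nu (x 0) * (\<Prod>i<n. ?p (x i) (x (Suc i)))"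
      using chain_uniform_cylinder[OF law d, of n x] 0(2) by (simp add: Ball_def)
    have "has_bochner_integral P (\<lambda>\<omega>. h (x 0) * indicator (?cyl 0 x) \<omega>) (h (x 0) * measure P (?cyl 0 x))"
      using ms by (intro has_bochner_integral_mult_right has_bochner_integral_real_indicator)
        (auto simp: emeasure_eq_measure)
    moreover have "h (x 0) * indicator (?cyl 0 x) \<omega> = ?f 0 \<omega> * indicator (?cyl 0 x) \<omega>" for \<omega>
    proof (cases "\<omega> \<in> ?cyl 0 x")
      case True
      then have "\<forall>i\<in>{0..n}. \<omega> (real i * d) = x i" by blast
      from bspec[OF this, of 0] show ?thesis by simp
    qed simp
    ultimately have "has_bochner_integral P (\<lambda>\<omega>. ?f 0 \<omega> * indicator (?cyl 0 x) \<omega>) (h (x 0) * measure P (?cyl 0 x))"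
      by (simp only:)
    moreover have "?F 0 (x 0) * (\<Prod>i\<in>{0..<n}. ?p (x i) (x (Suc i))) = h (x 0) * measure P (?cyl 0 x)"
      unfolding meas by (simp add: lessThan_atLeast0 mult_ac)
    ultimately show ?case by (simp only:)
  next
    case (Suc r)
    have "has_bochner_integral P
        (\<lambda>\<omega>. \<Sum>z<k. ?f r \<omega> * indicator (?cyl r (x(r := z))) \<omega> * w r z (x (Suc r)))
        (\<Sum>z<k. ?F r ((x(r := z)) r) * (\<Prod>i\<in>{r..<n}. ?p ((x(r := z)) i) ((x(r := z)) (Suc i))) * w r z (x (Suc r)))"
      using Suc.prems by (intro has_bochner_integral_sum has_bochner_integral_mult_left Suc.IH) auto
    moreover have "(\<Sum>z<k. ?F r ((x(r := z)) r) * (\<Prod>i\<in>{r..<n}. ?p ((x(r := z)) i) ((x(r := z)) (Suc i))) * w r z (x (Suc r)))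
        = ?F (Suc r) (x (Suc r)) * (\<Prod>i\<in>{Suc r..<n}. ?p (x i) (x (Suc i)))"
    proof -
      have pe: "(\<Prod>i\<in>{r..<n}. ?p ((x(r := z)) i) ((x(r := z)) (Suc i)))
          = ?p z (x (Suc r)) * (\<Prod>i\<in>{Suc r..<n}. ?p (x i) (x (Suc i)))" for z
      proof -
        have "{r..<n} = insert r {Suc r..<n}" using Suc.prems by auto
        moreover have "(\<Prod>i\<in>{Suc r..<n}. ?p ((x(r := z)) i) ((x(r := z)) (Suc i)))
            = (\<Prod>i\<in>{Suc r..<n}. ?p (x i) (x (Suc i)))"
          by (rule prod.cong) auto
        ultimately show ?thesis by simp
      qed
      show ?thesis
        unfolding fwd.simps fun_upd_same pe sum_distrib_right
        by (simp only: mult.assoc mult.commute mult.left_commute)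
    qed
    moreover have "(\<Sum>z<k. ?f r \<omega> * indicator (?cyl r (x(r := z))) \<omega> * w r z (x (Suc r)))
        = ?f (Suc r) \<omega> * indicator (?cyl (Suc r) x) \<omega>" if w: "\<omega> \<in> space P" for \<omega>
    proof -
      have ind: "indicator A a = (if R then indicator B a else (0::real))" if "a \<in> A \<longleftrightarrow> R \<and> a \<in> B"
        for A B :: "(real \<Rightarrow> nat) set" and a R using that by (simp add: indicator_def)
      have "indicator (?cyl r (x(r := z))) \<omega>
          = (if z = \<omega> (real r * d) then indicator (?cyl (Suc r) x) \<omega> else (0::real))" for z
      proof -
        have "{r..n} = insert r {Suc r..n}" using Suc.prems by auto
        then have "\<omega> \<in> ?cyl r (x(r := z)) \<longleftrightarrow> z = \<omega> (real r * d) \<and> \<omega> \<in> ?cyl (Suc r) x"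
          using w by auto
        then show ?thesis by (rule ind)
      qed
      then have "(\<Sum>z<k. ?f r \<omega> * indicator (?cyl r (x(r := z))) \<omega> * w r z (x (Suc r)))
         = (\<Sum>z<k. if z = \<omega> (real r * d) then ?f r \<omega> * indicator (?cyl (Suc r) x) \<omega> * w r z (x (Suc r)) else 0)"
        by (intro sum.cong) auto
      also have "\<dots> = ?f r \<omega> * indicator (?cyl (Suc r) x) \<omega> * w r (\<omega> (real r * d)) (x (Suc r))"
        using st[OF w, of r] by simp
      also have "\<dots> = ?f (Suc r) \<omega> * indicator (?cyl (Suc r) x) \<omega>"
      proof (cases "\<omega> \<in> ?cyl (Suc r) x")
        case True
        then have "\<forall>i\<in>{Suc r..n}. \<omega> (real i * d) = x i" by blast
        from bspec[OF this, of "Suc r"] have "\<omega> (real (Suc r) * d) = x (Suc r)"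
          using Suc.prems(1) by simp
        then show ?thesis by (simp only: prod.lessThan_Suc mult.assoc mult.commute mult.left_commute)
      qed simp
      finally show ?thesis .
    qed
    ultimately show ?case by (subst has_bochner_integral_cong[OF refl _ refl]) (auto simp del: fwd.simps)
  qed
  have "has_bochner_integral P (\<lambda>\<omega>. \<Sum>y<k. ?f n \<omega> * indicator (?cyl n (\<lambda>_. y)) \<omega>) (\<Sum>y<k. ?F n y)"
    using main[of n "\<lambda>_. _"] by (intro has_bochner_integral_sum) auto
  moreover have "(\<Sum>y<k. ?f n \<omega> * indicator (?cyl n (\<lambda>_. y)) \<omega>) = ?f n \<omega>" if w: "\<omega> \<in> space P" for \<omega>
  proof -
    have "(\<Sum>y<k. ?f n \<omega> * indicator (?cyl n (\<lambda>_. y)) \<omega>) = (\<Sum>y<k. if y = \<omega> (real n * d) then ?f n \<omega> else 0)"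
      using w by (intro sum.cong) (auto simp: indicator_def)
    then show ?thesis using st[OF w, of n] by simp
  qed
  ultimately show ?thesis by (subst has_bochner_integral_cong[OF refl _ refl]) auto
qed

section \<open>Tilted transition kernels and the path density\<close>

lemma finite_op_free_gen: "finite_op k (free_gen k) (\<lambda>x y. free_gen k (indicator {y}) x)"
  and finite_op_gibbs_gen: "finite_op k (gibbs_gen k u) (\<lambda>x y. gibbs_gen k u (indicator {y}) x)"
proof -
  have ex: "(\<Sum>l<k. c * indicator {l} z * f l) = c * f z" if "z < k" for z c and f :: "nat \<Rightarrow> real"
  proof -
    have "(\<Sum>l<k. c * indicator {l} z * f l) = (\<Sum>l<k. if l = z then c * f z else 0)"
      by (intro sum.cong) (auto simp: indicator_def)
    then show ?thesis using that by simp
  qed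
  show "finite_op k (free_gen k) (\<lambda>x y. free_gen k (indicator {y}) x)"
  proof
    fix i f assume i: "i < k"
    have "(\<Sum>l<k. free_gen k (indicator {l}) i * f l)
        = (\<Sum>l<k. real k * indicator {l} (nxt k i) * f l) + (\<Sum>l<k. real k * indicator {l} (prv k i) * f l)
          - (\<Sum>l<k. 2 * real k * indicator {l} i * f l)"
      unfolding free_gen_def lap_def by (simp add: sum.distrib sum_subtractf algebra_simps)
    then show "free_gen k f i = (\<Sum>l<k. free_gen k (indicator {l}) i * f l)"
      unfolding ex[OF i] ex[OF nxt_less[OF i]] ex[OF prv_less[OF i]]
      by (simp add: free_gen_def lap_def algebra_simps)
  qed
  show "finite_op k (gibbs_gen k u) (\<lambda>x y. gibbs_gen k u (indicator {y}) x)"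
  proof
    fix i f assume i: "i < k"
    let ?a = "real k * (u (nxt k i) / u i)" and ?b = "real k * (u (prv k i) / u i)"
    have g: "gibbs_gen k u f i = ?a * f (nxt k i) + ?b * f (prv k i) - (?a + ?b) * f i" for f
      unfolding gibbs_gen_def by (simp only: right_diff_distrib distrib_right)
    have "(\<Sum>l<k. gibbs_gen k u (indicator {l}) i * f l)
        = (\<Sum>l<k. ?a * indicator {l} (nxt k i) * f l) + (\<Sum>l<k. ?b * indicator {l} (prv k i) * f l)
          - (\<Sum>l<k. (?a + ?b) * indicator {l} i * f l)"
      unfolding g sum.distrib[symmetric] sum_subtractf[symmetric]
      by (intro sum.cong refl) (simp only: left_diff_distrib distrib_right)
    then show "gibbs_gen k u f i = (\<Sum>l<k. gibbs_gen k u (indicator {l}) i * f l)"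
      unfolding ex[OF i] ex[OF nxt_less[OF i]] ex[OF prv_less[OF i]] g[of f] by (rule sym)
  qed
qed

text \<open>With \<open>c = kV - lam\<close> this is a one-step approximation of the transition probabilities of the Gibbs chain,
though not itself a stochastic matrix. The potential is evaluated at the end point, to match right Riemann sums.\<close>

definition tilt :: "nat \<Rightarrow> (nat \<Rightarrow> real) \<Rightarrow> (nat \<Rightarrow> real) \<Rightarrow> real \<Rightarrow> nat \<Rightarrow> nat \<Rightarrow> real" where
  "tilt k c u h x y = exp_op (free_gen k) h (indicator {y}) x * (exp (h * c y) * u y / u x)"

definition tilt_op :: "nat \<Rightarrow> (nat \<Rightarrow> real) \<Rightarrow> (nat \<Rightarrow> real) \<Rightarrow> real \<Rightarrow> (nat \<Rightarrow> real) \<Rightarrow> nat \<Rightarrow> real" where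
  "tilt_op k c u h f x = (\<Sum>y<k. tilt k c u h x y * f y)"

lemma finite_op_tilt_op: "finite_op k (tilt_op k c u h) (tilt k c u h)"
  by unfold_locales (simp add: tilt_op_def)

text \<open>The derivative of the tilted kernel at \<open>h = 0\<close> is \<open>L (x, y) u y / u x\<close> plus \<open>c x\<close> on the
diagonal. By the eigenvalue equation the diagonal term \<open>c x - 2 k\<close> is minus the sum of the two jump rates
\<open>k u y / u x\<close>, so this is the matrix of the Gibbs generator.\<close>

lemma tilt_op_power_tendsto:
  assumes P: "perron_triple V k lam u mu" and t: "0 \<le> t" and j: "j < k"
    and c: "c = (\<lambda>y. real k * pot V k y - lam)"
  shows "(\<lambda>n. (tilt_op k c u (t / real n) ^^ n) f j) \<longlonglongrightarrow> exp_op (gibbs_gen k u) t f j"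
proof (rule finite_op.product_formula[OF finite_op_gibbs_gen finite_op_tilt_op _ _ t j])
  interpret L: finite_op k "free_gen k" "\<lambda>x y. free_gen k (indicator {y}) x"
    by (rule finite_op_free_gen)
  have pos: "\<And>j. j < k \<Longrightarrow> 0 < u j" using P by (auto simp: perron_triple_def)
  fix x y assume xy: "x < k" "y < k"
  show "tilt k c u 0 x y = indicator {y} x"
    using pos[OF xy(1)] by (auto simp: tilt_def L.exp_0 indicator_def)
  have q: "free_gen k (indicator {y}) x * (u y / u x) + indicator {y} x * (c y * u y / u x)
      = gibbs_gen k u (indicator {y}) x"
  proof -
    have L: "free_gen k (indicator {y}) x * u y = real k *
        (indicator {y} (nxt k x) * u (nxt k x) + indicator {y} (prv k x) * u (prv k x) - 2 * indicator {y} x * u x)"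
      by (auto simp: free_gen_def lap_def indicator_def)
    have "indicator {y} x * (c y * u y / u x) = indicator {y} x * c x"
      using pos[OF xy(1)] by (auto simp: indicator_def)
    moreover have "c x = - real k * (u (nxt k x) / u x + u (prv k x) / u x - 2)"
      using perron_eigen_ratio[OF P xy(1)] unfolding c by (simp add: algebra_simps)
    ultimately have c': "indicator {y} x * (c y * u y / u x)
        = indicator {y} x * (- real k * (u (nxt k x) / u x + u (prv k x) / u x - 2))" by (simp only:)
    show ?thesis
      unfolding times_divide_eq_right[of _ "u y"] L c' using pos[OF xy(1)]
      by (simp add: gibbs_gen_def diff_divide_distrib add_divide_distrib algebra_simps)
  qed
  have "((\<lambda>h. exp_op (free_gen k) h (indicator {y}) x) has_real_derivative
      exp_op (free_gen k) 0 (free_gen k (indicator {y})) x) (at 0)"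
    by (rule L.exp_deriv[OF xy(1)])
  then have "((\<lambda>h. tilt k c u h x y) has_real_derivative
      free_gen k (indicator {y}) x * (u y / u x) + indicator {y} x * (c y * u y / u x)) (at 0)"
    unfolding tilt_def using pos[OF xy(1)]
    by (auto intro!: derivative_eq_intros simp: L.exp_0 add_divide_distrib mult.commute)
  then show "((\<lambda>h. tilt k c u h x y) has_real_derivative gibbs_gen k u (indicator {y}) x) (at 0)"
    unfolding q .
qed

text \<open>If the state is prescribed at every \<open>b\<close>-th step, the forward recursion splits into blocks: after
each prescribed time it starts afresh from a point mass, and within a block it computes a power of \<open>Kop\<close>.\<close>

lemma fwd_blocks:
  assumes K: "finite_op k Kop K" and x: "\<And>i. i \<le> m \<Longrightarrow> x i < k" and b: "0 < b" and i: "i \<le> m" and y: "y < k"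
  defines "W \<equiv> \<lambda>j z y. K z y * (if b dvd Suc j \<and> y \<noteq> x (Suc j div b) then 0 else (1::real))"
  shows "fwd k (\<lambda>y. a * indicator {x 0} y) W (i * b) y
       = a * (\<Prod>r<i. (Kop ^^ b) (indicator {x (Suc r)}) (x r)) * indicator {x i} y"
  using i y
proof (induction i arbitrary: y)
  case 0
  then show ?case by simp
next
  case (Suc i)
  interpret finite_op k Kop K by (rule K)
  let ?F = "fwd k (\<lambda>y. a * indicator {x 0} y) W"
  define B where "B = a * (\<Prod>r<i. (Kop ^^ b) (indicator {x (Suc r)}) (x r))"
  have xi: "x i < k" using x Suc.prems by simp
  have step: "(\<Sum>z<k. (Kop ^^ l) (indicator {z}) (x i) * K z y) = (Kop ^^ Suc l) (indicator {y}) (x i)"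
    if "y < k" for l y
  proof -
    have Ky: "Kop (indicator {y}) z = K z y" if "z < k" for z
    proof -
      have "Kop (indicator {y}) z = (\<Sum>l<k. if l = y then K z y else 0)"
        unfolding op[OF that] by (intro sum.cong) (auto simp: indicator_def)
      then show ?thesis using \<open>y < k\<close> by simp
    qed
    have "(Kop ^^ Suc l) (indicator {y}) (x i) = (\<Sum>z<k. Kop (indicator {y}) z * (Kop ^^ l) (indicator {z}) (x i))"
      unfolding funpow_Suc_right o_apply by (rule pow_expand[OF xi])
    then show ?thesis by (simp add: Ky mult.commute)
  qed
  have inner: "?F (i * b + l) y = B * (Kop ^^ l) (indicator {y}) (x i)" if "l < b" "y < k" for l y
    using that
  proof (induction l arbitrary: y)
    case 0
    have "indicator {x i} y = (indicator {y} (x i) :: real)" by (auto simp: indicator_def)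
    then show ?case using Suc.IH[of y] Suc.prems 0 by (simp add: B_def)
  next
    case (Suc l)
    have "\<not> b dvd Suc (i * b + l)"
    proof
      assume "b dvd Suc (i * b + l)"
      then have "b dvd Suc l" using dvd_add_right_iff[of b "i * b" "Suc l"] by simp
      then show False using Suc.prems(1) by (auto dest: dvd_imp_le)
    qed
    then have W: "W (i * b + l) z y = K z y" for z by (simp add: W_def)
    have "?F (i * b + Suc l) y = (\<Sum>z<k. ?F (i * b + l) z * K z y)"
      unfolding add_Suc_right fwd.simps W ..
    also have "\<dots> = (\<Sum>z<k. B * (Kop ^^ l) (indicator {z}) (x i) * K z y)"
      using Suc by (intro sum.cong) auto
    also have "\<dots> = B * (Kop ^^ Suc l) (indicator {y}) (x i)"
      unfolding step[OF Suc.prems(2), symmetric] by (simp only: sum_distrib_left mult.assoc)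
    finally show ?case .
  qed
  obtain l where l: "b = Suc l" using b by (cases b) auto
  have W: "W (i * b + l) z y = K z y * indicator {x (Suc i)} y" for z
  proof -
    have "Suc (i * b + l) = Suc i * b" using l by simp
    then have "b dvd Suc (i * b + l)" "Suc (i * b + l) div b = Suc i"
      using b nonzero_mult_div_cancel_right[of b "Suc i"] by (simp_all only: dvd_triv_right)
    then show ?thesis unfolding W_def by (simp add: indicator_def)
  qed
  have "?F (Suc i * b) y = ?F (Suc (i * b + l)) y" unfolding l by (simp add: algebra_simps)
  also have "\<dots> = (\<Sum>z<k. ?F (i * b + l) z * (K z y * indicator {x (Suc i)} y))"
    unfolding fwd.simps W ..
  also have "\<dots> = (\<Sum>z<k. B * (Kop ^^ l) (indicator {z}) (x i) * K z y) * indicator {x (Suc i)} y"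
    unfolding sum_distrib_right using inner[of l] l by (intro sum.cong) auto
  also have "\<dots> = B * (Kop ^^ b) (indicator {y}) (x i) * indicator {x (Suc i)} y"
    unfolding l step[OF Suc.prems(2), symmetric] by (simp only: sum_distrib_left mult.assoc)
  also have "\<dots> = a * (\<Prod>r<Suc i. (Kop ^^ b) (indicator {x (Suc r)}) (x r)) * indicator {x (Suc i)} y"
    by (cases "y = x (Suc i)") (simp_all add: B_def)
  finally show ?case .
qed

lemma prod_if_zero_one: "(\<Prod>j<n. if R j then 0 else 1) = (if \<exists>j<n. R j then 0 else (1::real))"
  for n :: nat
  by (induction n) (auto simp: less_Suc_eq)

definition riemann_density ::
  "(nat \<Rightarrow> real) \<Rightarrow> (nat \<Rightarrow> real) \<Rightarrow> real \<Rightarrow> nat \<Rightarrow> (real \<Rightarrow> nat) \<Rightarrow> real" where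
  "riemann_density c u T N \<omega> =
     u (\<omega> T) / u (\<omega> 0) * exp (\<Sum>j<2 ^ N. T / 2 ^ N * c (\<omega> (real (Suc j) * (T / 2 ^ N))))"

definition path_density ::
  "(nat \<Rightarrow> real) \<Rightarrow> (nat \<Rightarrow> real) \<Rightarrow> real \<Rightarrow> (real \<Rightarrow> nat) \<Rightarrow> real" where
  "path_density c u T \<omega> =
     u (\<omega> T) / u (\<omega> 0) * exp (\<integral>s. indicator {0<..T} s * c (\<omega> s) \<partial>lborel)"

text \<open>The quotient \<open>u (X T) / u (X 0)\<close> telescopes, which turns the density into a product over the
edges of the mesh.\<close>

lemma riemann_density_prod:
  assumes w: "\<omega> \<in> cadlag_paths k" and T: "0 \<le> T" and pos: "\<And>j. j < k \<Longrightarrow> 0 < u j"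
  shows "riemann_density c u T N \<omega>
     = (\<Prod>j<2 ^ N. exp (T / 2 ^ N * c (\<omega> (real (Suc j) * (T / 2 ^ N))))
          * u (\<omega> (real (Suc j) * (T / 2 ^ N))) / u (\<omega> (real j * (T / 2 ^ N))))"
proof -
  have ne: "u (\<omega> (real j * (T / 2 ^ N))) \<noteq> 0" for j
    using pos[OF path_in_states[OF w], of "real j * (T / 2 ^ N)"] T by simp
  have "(\<Prod>j<n. u (\<omega> (real (Suc j) * (T / 2 ^ N))) / u (\<omega> (real j * (T / 2 ^ N))))
      = u (\<omega> (real n * (T / 2 ^ N))) / u (\<omega> (real 0 * (T / 2 ^ N)))" for n
  proof (induction n)
    case 0 then show ?case using ne[of 0] by simp
  next
    case (Suc n) show ?case unfolding prod.lessThan_Suc Suc using ne[of n] by simp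
  qed
  from this[of "2 ^ N"] have tel: "(\<Prod>j<2 ^ N. u (\<omega> (real (Suc j) * (T / 2 ^ N))) / u (\<omega> (real j * (T / 2 ^ N))))
      = u (\<omega> T) / u (\<omega> 0)" by simp
  show ?thesis
    unfolding riemann_density_def tel[symmetric] exp_sum[OF finite_lessThan] prod.distrib[symmetric]
    by (simp only: mult.commute times_divide_eq_right)
qed

lemma riemann_density_tendsto:
  assumes "\<omega> \<in> cadlag_paths k" "0 \<le> T"
  shows "(\<lambda>N. riemann_density c u T N \<omega>) \<longlonglongrightarrow> path_density c u T \<omega>"
  unfolding riemann_density_def path_density_def
  by (intro tendsto_intros right_riemann_sums_tendsto[OF assms])

lemma riemann_sum_abs_le:
  assumes w: "\<omega> \<in> cadlag_paths k" and T: "0 \<le> T"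
  shows "\<bar>\<Sum>j<2 ^ N. T / 2 ^ N * c (\<omega> (real (Suc j) * (T / 2 ^ N)))\<bar> \<le> T * (\<Sum>i<k. \<bar>c i\<bar>)"
proof -
  have "\<bar>c (\<omega> (real (Suc j) * (T / 2 ^ N)))\<bar> \<le> (\<Sum>i<k. \<bar>c i\<bar>)" for j
    using path_in_states[OF w] T by (intro member_le_sum) auto
  then have "\<bar>\<Sum>j<2 ^ N. T / 2 ^ N * c (\<omega> (real (Suc j) * (T / 2 ^ N)))\<bar>
      \<le> (\<Sum>j<(2::nat) ^ N. T / 2 ^ N * (\<Sum>i<k. \<bar>c i\<bar>))"
    using T by (intro order_trans[OF sum_abs] sum_mono) (auto simp: abs_mult intro!: mult_left_mono divide_right_mono)
  then show ?thesis by simp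
qed

lemma riemann_density_bound:
  assumes w: "\<omega> \<in> cadlag_paths k" and T: "0 \<le> T" and pos: "\<And>j. j < k \<Longrightarrow> 0 < u j"
  shows "0 \<le> riemann_density c u T N \<omega>"
    and "riemann_density c u T N \<omega> \<le> (\<Sum>i<k. u i) * (\<Sum>i<k. 1 / u i) * exp (T * (\<Sum>i<k. \<bar>c i\<bar>))"
proof -
  have s: "\<omega> T < k" "\<omega> 0 < k" using path_in_states[OF w] T by auto
  have nn: "0 \<le> u j" if "j < k" for j using pos[OF that] by simp
  have 1: "u (\<omega> T) \<le> (\<Sum>i<k. u i)" using s nn by (intro member_le_sum) auto
  have 2: "1 / u (\<omega> 0) \<le> (\<Sum>i<k. 1 / u i)"
    using s nn by (intro member_le_sum[of _ _ "\<lambda>i. 1 / u i"]) auto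
  have 3: "exp (\<Sum>j<2 ^ N. T / 2 ^ N * c (\<omega> (real (Suc j) * (T / 2 ^ N)))) \<le> exp (T * (\<Sum>i<k. \<bar>c i\<bar>))"
    using riemann_sum_abs_le[OF w T, where c = c and N = N] by (simp only: exp_le_cancel_iff)
  have form: "riemann_density c u T N \<omega> =
      u (\<omega> T) * (1 / u (\<omega> 0)) * exp (\<Sum>j<2 ^ N. T / 2 ^ N * c (\<omega> (real (Suc j) * (T / 2 ^ N))))"
    by (simp add: riemann_density_def)
  have p: "0 \<le> u (\<omega> T)" "0 \<le> 1 / u (\<omega> 0)" using nn s by auto
  show "0 \<le> riemann_density c u T N \<omega>" unfolding form using p by (intro mult_nonneg_nonneg) auto
  show "riemann_density c u T N \<omega> \<le> (\<Sum>i<k. u i) * (\<Sum>i<k. 1 / u i) * exp (T * (\<Sum>i<k. \<bar>c i\<bar>))"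
    unfolding form using 1 2 3 p nn
    by (intro mult_mono) (auto intro!: sum_nonneg mult_nonneg_nonneg)
qed

lemma coordinate_function_measurable:
  assumes "0 \<le> t" "t \<le> T"
  shows "(\<lambda>\<omega>. g (\<omega> t) :: real) \<in> borel_measurable (path_past k T)"
  using measurable_compose[OF path_past_coordinate_measurable[OF assms], of g borel] by simp

lemma riemann_sum_measurable:
  assumes T: "0 \<le> T"
  shows "(\<lambda>\<omega>. \<Sum>j<2 ^ N. T / 2 ^ N * c (\<omega> (real (Suc j) * (T / 2 ^ N)))) \<in> borel_measurable (path_past k T)"
  using dyadic_time_bounds[OF T, of "Suc _" N]
  by (intro borel_measurable_sum borel_measurable_times borel_measurable_const coordinate_function_measurable)
     (auto simp: Suc_le_eq)

lemma riemann_density_measurable: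
  assumes T: "0 \<le> T" shows "riemann_density c u T N \<in> borel_measurable (path_past k T)"
  unfolding riemann_density_def[abs_def] using T
  by (intro borel_measurable_times borel_measurable_divide borel_measurable_exp riemann_sum_measurable
      coordinate_function_measurable measurable_compose[OF riemann_sum_measurable borel_measurable_exp]) auto

lemma path_integral_measurable:
  fixes c :: "nat \<Rightarrow> real"
  assumes T: "0 \<le> T"
  shows "(\<lambda>\<omega>. \<integral>s. indicator {0<..T} s * c (\<omega> s) \<partial>lborel) \<in> borel_measurable (path_past k T)"
  by (rule borel_measurable_LIMSEQ_real[OF right_riemann_sums_tendsto[OF _ T] riemann_sum_measurable[OF T]])
     (simp add: space_path_past)

lemma path_density_measurable:
  assumes T: "0 \<le> T" shows "path_density c u T \<in> borel_measurable (path_past k T)"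
  by (rule borel_measurable_LIMSEQ_real[OF riemann_density_tendsto[OF _ T] riemann_density_measurable[OF T]])
     (simp add: space_path_past)

section \<open>The entropy rate of the Gibbs chain\<close>

text \<open>The mesh \<open>T / 2 ^ (m + a)\<close> refines the one of the cylinder by the factor \<open>b = 2 ^ a\<close>. The
indicator of the cylinder is spread over the edge weights: the edge that ends at step \<open>Suc j\<close> carries a
constraint when \<open>b\<close> divides \<open>Suc j\<close>.\<close>

lemma riemann_density_cylinder_integral:
  assumes law: "chain_law k (free_gen k) nu P" and T: "0 \<le> T" and pos: "\<And>j. j < k \<Longrightarrow> 0 < u j"
    and x: "\<And>i. i \<le> 2 ^ m \<Longrightarrow> x i < k"
  shows "has_bochner_integral P (\<lambda>\<omega>. indicator (dyadic_cyl k T m x) \<omega> * riemann_density c u T (m + a) \<omega>)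
     (nu (x 0) * (\<Prod>r<2 ^ m. (tilt_op k c u (T / 2 ^ m / 2 ^ a) ^^ (2 ^ a)) (indicator {x (Suc r)}) (x r)))"
proof -
  define b :: nat where "b = 2 ^ a"
  define d where "d = T / 2 ^ (m + a)"
  have b: "0 < b" by (simp add: b_def)
  have d0: "0 \<le> d" using T by (simp add: d_def)
  have n: "2 ^ (m + a) = 2 ^ m * b" by (simp add: b_def power_add)
  have refine: "real (i * b) * d = real i * (T / 2 ^ m)" for i
    using dyadic_refine[of m "m + a" i T] by (simp add: b_def d_def)
  have sp: "space P = cadlag_paths k" using law by (simp add: chain_law_def)
  let ?R = "\<lambda>j y. b dvd Suc j \<and> y \<noteq> x (Suc j div b)"
  let ?A = "\<lambda>z y. exp (d * c y) * u y / u z"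
  define w where "w j z y = ?A z y * (if ?R j y then 0 else 1)" for j z y
  have "has_bochner_integral P
      (\<lambda>\<omega>. indicator {x 0} (\<omega> 0) * (\<Prod>j<2 ^ m * b. w j (\<omega> (real j * d)) (\<omega> (real (Suc j) * d))))
      (\<Sum>y<k. fwd k (\<lambda>y. nu y * indicator {x 0} y)
          (\<lambda>j z y. exp_op (free_gen k) d (indicator {y}) z * w j z y) (2 ^ m * b) y)"
    by (rule chain_path_integral[OF law d0])
  moreover have "(\<Sum>y<k. fwd k (\<lambda>y. nu y * indicator {x 0} y)
          (\<lambda>j z y. exp_op (free_gen k) d (indicator {y}) z * w j z y) (2 ^ m * b) y)
      = nu (x 0) * (\<Prod>r<2 ^ m. (tilt_op k c u d ^^ b) (indicator {x (Suc r)}) (x r))"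
  proof -
    have "exp_op (free_gen k) d (indicator {y}) z * w j z y = tilt k c u d z y * (if ?R j y then 0 else 1)" for j z y
      by (simp only: tilt_def w_def mult.assoc)
    moreover have "nu y * indicator {x 0} y = nu (x 0) * indicator {x 0} y" for y
      by (auto simp: indicator_def)
    ultimately have "(\<Sum>y<k. fwd k (\<lambda>y. nu y * indicator {x 0} y)
          (\<lambda>j z y. exp_op (free_gen k) d (indicator {y}) z * w j z y) (2 ^ m * b) y)
       = (\<Sum>y<k. fwd k (\<lambda>y. nu (x 0) * indicator {x 0} y)
          (\<lambda>j z y. tilt k c u d z y * (if ?R j y then 0 else 1)) (2 ^ m * b) y)" by (simp only:)
    also have "\<dots> = (\<Sum>y<k. nu (x 0) * (\<Prod>r<2 ^ m. (tilt_op k c u d ^^ b) (indicator {x (Suc r)}) (x r))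
          * indicator {x (2 ^ m)} y)"
      by (intro sum.cong refl fwd_blocks[OF finite_op_tilt_op _ b, where m = "2 ^ m"]) (auto intro: x)
    also have "\<dots> = (\<Sum>y<k. if y = x (2 ^ m)
        then nu (x 0) * (\<Prod>r<2 ^ m. (tilt_op k c u d ^^ b) (indicator {x (Suc r)}) (x r)) else 0)"
      by (intro sum.cong) (auto simp: indicator_def)
    finally show ?thesis using x[of "2 ^ m"] by simp
  qed
  moreover have "indicator {x 0} (\<omega> 0) * (\<Prod>j<2 ^ m * b. w j (\<omega> (real j * d)) (\<omega> (real (Suc j) * d)))
      = indicator (dyadic_cyl k T m x) \<omega> * riemann_density c u T (m + a) \<omega>" if \<omega>: "\<omega> \<in> space P" for \<omega>
  proof -
    have "riemann_density c u T (m + a) \<omega> = (\<Prod>j<2 ^ m * b. ?A (\<omega> (real j * d)) (\<omega> (real (Suc j) * d)))"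
      using riemann_density_prod[where u = u and c = c and N = "m + a", OF _ T pos, of \<omega>] \<omega> by (simp only: sp d_def n)
    then have prd: "(\<Prod>j<2 ^ m * b. w j (\<omega> (real j * d)) (\<omega> (real (Suc j) * d)))
       = riemann_density c u T (m + a) \<omega> * (if \<exists>j<2 ^ m * b. ?R j (\<omega> (real (Suc j) * d)) then 0 else 1)"
      unfolding w_def prod.distrib prod_if_zero_one by (simp only:)
    have cyl: "\<omega> \<in> dyadic_cyl k T m x \<longleftrightarrow> \<omega> 0 = x 0 \<and> \<not> (\<exists>j<2 ^ m * b. ?R j (\<omega> (real (Suc j) * d)))"
    proof (intro iffI conjI notI)
      assume "\<omega> \<in> dyadic_cyl k T m x"
      then have w: "\<omega> (real i * (T / 2 ^ m)) = x i" if "i \<le> 2 ^ m" for i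
        using that unfolding dyadic_cyl_def by blast
      show "\<omega> 0 = x 0" using w[of 0] by simp
      assume "\<exists>j<2 ^ m * b. ?R j (\<omega> (real (Suc j) * d))"
      then obtain j where j: "j < 2 ^ m * b" "b dvd Suc j" "\<omega> (real (Suc j) * d) \<noteq> x (Suc j div b)" by blast
      define i where "i = Suc j div b"
      have ji: "Suc j = i * b" using j(2) by (simp add: i_def)
      have "i * b \<le> 2 ^ m * b" using j(1) unfolding ji[symmetric] by (rule Suc_leI)
      then have "i \<le> 2 ^ m" using b by simp
      from w[OF this] have "\<omega> (real (Suc j) * d) = x i" unfolding ji refine .
      then show False using j(3) by (simp add: i_def)
    next
      assume R: "\<omega> 0 = x 0 \<and> \<not> (\<exists>j<2 ^ m * b. ?R j (\<omega> (real (Suc j) * d)))"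
      have "\<omega> (real i * (T / 2 ^ m)) = x i" if i: "i \<le> 2 ^ m" for i
      proof (cases "i = 0")
        case True then show ?thesis using R by simp
      next
        case False
        define j where "j = i * b - 1"
        have ib: "0 < i * b" using False b by simp
        then have j: "Suc j = i * b" by (simp add: j_def)
        have "i * b \<le> 2 ^ m * b" using i by simp
        then have "j < 2 ^ m * b" using j by linarith
        then have "\<not> ?R j (\<omega> (real (Suc j) * d))" using R by blast
        then have "\<omega> (real (i * b) * d) = x (i * b div b)" unfolding j by simp
        then show ?thesis unfolding refine using b by simp
      qed
      then show "\<omega> \<in> dyadic_cyl k T m x" using \<omega> unfolding dyadic_cyl_def sp by blast
    qed
    show ?thesis
      unfolding prd using cyl by (cases "\<omega> \<in> dyadic_cyl k T m x") (auto simp: indicator_def)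
  qed
  ultimately have "has_bochner_integral P (\<lambda>\<omega>. indicator (dyadic_cyl k T m x) \<omega> * riemann_density c u T (m + a) \<omega>)
      (nu (x 0) * (\<Prod>r<2 ^ m. (tilt_op k c u d ^^ b) (indicator {x (Suc r)}) (x r)))"
    by (subst (asm) has_bochner_integral_cong[OF refl _ refl]) auto
  moreover have "d = T / 2 ^ m / 2 ^ a" by (simp add: d_def power_add)
  ultimately show ?thesis by (simp only: b_def)
qed

lemma chain_past_subalgebra: "chain_law k Q nu P \<Longrightarrow> subalgebra P (path_past k T)"
  using sets_path_past_subset[of k T] by (auto simp: subalgebra_def chain_law_def space_path_past)

text \<open>Let \<open>a \<rightarrow> \<infinity>\<close> in \<open>riemann_density_cylinder_integral\<close>: the left-hand sides converge by dominated
convergence, the right-hand sides by \<open>tilt_op_power_tendsto\<close> with \<open>n = 2 ^ a\<close>.\<close>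

lemma path_density_cylinder_integral:
  assumes perron: "perron_triple V k lam u mu" and c: "c = (\<lambda>y. real k * pot V k y - lam)"
    and law: "chain_law k (free_gen k) nu P" and lawV: "chain_law k (gibbs_gen k u) nu PV" and T: "0 \<le> T"
  shows "has_bochner_integral P (\<lambda>\<omega>. indicator (dyadic_cyl k T m x) \<omega> * path_density c u T \<omega>)
     (measure PV (dyadic_cyl k T m x))"
proof (cases "\<forall>i\<le>2 ^ m. x i < k")
  case False
  then have "dyadic_cyl k T m x = {}"
    using path_in_states dyadic_time_bounds(1)[OF T] unfolding dyadic_cyl_def by (auto; metis)
  then show ?thesis by (simp add: has_bochner_integral_zero)
next
  case True
  have pos: "\<And>j. j < k \<Longrightarrow> 0 < u j" using perron by (auto simp: perron_triple_def)
  interpret prob_space P using law by (simp add: chain_law_def)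
  have sp: "space P = cadlag_paths k" and spV: "space PV = cadlag_paths k"
    using law lawV by (auto simp: chain_law_def)
  have sub: "subalgebra P (path_past k T)" by (rule chain_past_subalgebra[OF law])
  let ?ind = "\<lambda>\<omega>. indicator (dyadic_cyl k T m x) \<omega> :: real"
  define Bd where "Bd = (\<Sum>i<k. u i) * (\<Sum>i<k. 1 / u i) * exp (T * (\<Sum>i<k. \<bar>c i\<bar>))"
  have im: "?ind \<in> borel_measurable P"
    using measurable_from_subalg[OF sub borel_measurable_indicator[OF dyadic_cyl_in_path_past[OF T]]] .
  have m1: "(\<lambda>\<omega>. ?ind \<omega> * riemann_density c u T N \<omega>) \<in> borel_measurable P" for N
    by (intro borel_measurable_times im measurable_from_subalg[OF sub riemann_density_measurable[OF T]])
  have m2: "(\<lambda>\<omega>. ?ind \<omega> * path_density c u T \<omega>) \<in> borel_measurable P"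
    by (intro borel_measurable_times im measurable_from_subalg[OF sub path_density_measurable[OF T]])
  have lim: "AE \<omega> in P. (\<lambda>a. ?ind \<omega> * riemann_density c u T (m + a) \<omega>) \<longlonglongrightarrow> ?ind \<omega> * path_density c u T \<omega>"
  proof (rule AE_I2)
    fix \<omega> assume "\<omega> \<in> space P"
    then have "(\<lambda>N. riemann_density c u T N \<omega>) \<longlonglongrightarrow> path_density c u T \<omega>"
      using sp by (intro riemann_density_tendsto[OF _ T]) auto
    from LIMSEQ_ignore_initial_segment[OF this, of m]
    show "(\<lambda>a. ?ind \<omega> * riemann_density c u T (m + a) \<omega>) \<longlonglongrightarrow> ?ind \<omega> * path_density c u T \<omega>"
      by (intro tendsto_mult tendsto_const) (simp add: add.commute)
  qed
  have bound: "AE \<omega> in P. norm (?ind \<omega> * riemann_density c u T (m + a) \<omega>) \<le> Bd" for a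
  proof (rule AE_I2)
    fix \<omega> assume "\<omega> \<in> space P"
    then have "\<omega> \<in> cadlag_paths k" using sp by simp
    from riemann_density_bound[where u = u and c = c and N = "m + a", OF this T pos]
    show "norm (?ind \<omega> * riemann_density c u T (m + a) \<omega>) \<le> Bd"
      unfolding Bd_def[symmetric] by (auto simp: indicator_def)
  qed
  have int: "integrable P (\<lambda>\<omega>. ?ind \<omega> * path_density c u T \<omega>)"
    and conv: "(\<lambda>a. \<integral>\<omega>. ?ind \<omega> * riemann_density c u T (m + a) \<omega> \<partial>P)
       \<longlonglongrightarrow> (\<integral>\<omega>. ?ind \<omega> * path_density c u T \<omega> \<partial>P)"
    using integrable_dominated_convergence[OF m2 m1 integrable_const lim bound]
      integral_dominated_convergence[OF m2 m1 integrable_const lim bound] by auto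
  have "(\<lambda>a. nu (x 0) * (\<Prod>r<2 ^ m. (tilt_op k c u (T / 2 ^ m / 2 ^ a) ^^ (2 ^ a)) (indicator {x (Suc r)}) (x r)))
     \<longlonglongrightarrow> nu (x 0) * (\<Prod>r<2 ^ m. exp_op (gibbs_gen k u) (T / 2 ^ m) (indicator {x (Suc r)}) (x r))"
  proof (intro tendsto_mult tendsto_const tendsto_prod)
    fix r assume "r \<in> {..<(2::nat) ^ m}"
    then have "x r < k" using True by simp
    have "(\<lambda>n. (tilt_op k c u (T / 2 ^ m / real n) ^^ n) (indicator {x (Suc r)}) (x r))
        \<longlonglongrightarrow> exp_op (gibbs_gen k u) (T / 2 ^ m) (indicator {x (Suc r)}) (x r)"
      using T by (intro tilt_op_power_tendsto[OF perron _ \<open>x r < k\<close> c]) simp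
    moreover have "strict_mono (\<lambda>a. (2::nat) ^ a)" by (intro strict_monoI) simp
    ultimately have "((\<lambda>n. (tilt_op k c u (T / 2 ^ m / real n) ^^ n) (indicator {x (Suc r)}) (x r)) \<circ> (\<lambda>a. 2 ^ a))
        \<longlonglongrightarrow> exp_op (gibbs_gen k u) (T / 2 ^ m) (indicator {x (Suc r)}) (x r)"
      by (rule LIMSEQ_subseq_LIMSEQ)
    then show "(\<lambda>a. (tilt_op k c u (T / 2 ^ m / 2 ^ a) ^^ (2 ^ a)) (indicator {x (Suc r)}) (x r))
        \<longlonglongrightarrow> exp_op (gibbs_gen k u) (T / 2 ^ m) (indicator {x (Suc r)}) (x r)"
      by (simp add: o_def)
  qed
  moreover have "nu (x 0) * (\<Prod>r<2 ^ m. exp_op (gibbs_gen k u) (T / 2 ^ m) (indicator {x (Suc r)}) (x r))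
      = measure PV (dyadic_cyl k T m x)"
    using chain_uniform_cylinder[OF lawV, of "T / 2 ^ m" "2 ^ m" x] T True
    by (simp add: dyadic_cyl_def spV)
  moreover have "(\<integral>\<omega>. ?ind \<omega> * riemann_density c u T (m + a) \<omega> \<partial>P) =
      nu (x 0) * (\<Prod>r<2 ^ m. (tilt_op k c u (T / 2 ^ m / 2 ^ a) ^^ (2 ^ a)) (indicator {x (Suc r)}) (x r))" for a
    using True by (intro has_bochner_integral_integral_eq riemann_density_cylinder_integral[OF law T pos]) auto
  ultimately have "(\<integral>\<omega>. ?ind \<omega> * path_density c u T \<omega> \<partial>P) = measure PV (dyadic_cyl k T m x)"
    using LIMSEQ_unique[OF conv] by simp
  then show ?thesis using int by (simp add: has_bochner_integral_iff)
qed

lemma path_density_pos: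
  assumes "\<omega> \<in> cadlag_paths k" "0 \<le> T" "\<And>j. j < k \<Longrightarrow> 0 < u j"
  shows "0 < path_density c u T \<omega>"
  unfolding path_density_def using assms path_in_states[of \<omega> k]
  by (intro mult_pos_pos divide_pos_pos) auto

lemma gibbs_law_density:
  assumes perron: "perron_triple V k lam u mu" and c: "c = (\<lambda>y. real k * pot V k y - lam)"
    and law: "chain_law k (free_gen k) nu P" and lawV: "chain_law k (gibbs_gen k u) nu PV" and T: "0 \<le> T"
  shows "density (restr_to_subalg P (path_past k T)) (\<lambda>\<omega>. ennreal (path_density c u T \<omega>))
       = restr_to_subalg PV (path_past k T)" (is "density ?RP ?Z = ?RV")
proof -
  let ?F = "path_past k T" and ?G = "range (\<lambda>(m, x). dyadic_cyl k T m x)"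
  have pos: "\<And>j. j < k \<Longrightarrow> 0 < u j" using perron by (auto simp: perron_triple_def)
  have sp: "space P = cadlag_paths k" using law by (simp add: chain_law_def)
  have sub: "subalgebra P ?F" "subalgebra PV ?F" using chain_past_subalgebra law lawV by blast+
  have st: "sets ?RP = sets ?F" "sets ?RV = sets ?F" using sub by (simp_all add: sets_restr_to_subalg)
  interpret V: prob_space PV using lawV by (simp add: chain_law_def)
  have Zm: "?Z \<in> borel_measurable ?F" using path_density_measurable[OF T] by measurable
  have eq: "emeasure (density ?RP ?Z) (dyadic_cyl k T m x) = emeasure ?RV (dyadic_cyl k T m x)" for m x
  proof -
    let ?C = "dyadic_cyl k T m x"
    have C: "?C \<in> sets ?F" by (rule dyadic_cyl_in_path_past[OF T])
    have "emeasure (density ?RP ?Z) ?C = (\<integral>\<^sup>+\<omega>. ?Z \<omega> * indicator ?C \<omega> \<partial>?RP)"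
      using Zm C st measurable_cong_sets[OF st(1) refl] by (intro emeasure_density) blast+
    also have "\<dots> = (\<integral>\<^sup>+\<omega>. ?Z \<omega> * indicator ?C \<omega> \<partial>P)"
      using Zm C by (intro nn_integral_subalgebra2[OF sub(1)] borel_measurable_times_ennreal borel_measurable_indicator)
    also have "\<dots> = (\<integral>\<^sup>+\<omega>. ennreal (indicator ?C \<omega> * path_density c u T \<omega>) \<partial>P)"
      by (intro nn_integral_cong) (auto simp: indicator_def)
    also have "\<dots> = ennreal (\<integral>\<omega>. indicator ?C \<omega> * path_density c u T \<omega> \<partial>P)"
    proof (rule nn_integral_eq_integral)
      show "integrable P (\<lambda>\<omega>. indicator ?C \<omega> * path_density c u T \<omega>)"
        using path_density_cylinder_integral[OF perron c law lawV T] by (simp add: has_bochner_integral_iff)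
      show "AE \<omega> in P. 0 \<le> indicator ?C \<omega> * path_density c u T \<omega>"
        using path_density_pos[where u = u, OF _ T pos] sp by (intro AE_I2) (auto simp: indicator_def intro: less_imp_le)
    qed
    also have "\<dots> = ennreal (measure PV ?C)"
      using path_density_cylinder_integral[OF perron c law lawV T] by (simp add: has_bochner_integral_iff)
    also have "\<dots> = emeasure ?RV ?C"
      unfolding emeasure_restr_to_subalg[OF sub(2) C] by (simp add: V.emeasure_eq_measure)
    finally show ?thesis .
  qed
  \<comment> \<open>the coarsest cylinders cover the path space, which itself is not a cylinder\<close>
  define A where "A = (\<lambda>x. dyadic_cyl k T 0 x) ` ({..1} \<rightarrow>\<^sub>E {..<k})"
  show ?thesis
  proof (rule measure_eqI_generator_eq_countable[OF Int_stable_dyadic_cyl[OF T, of k]])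
    show "?G \<subseteq> Pow (cadlag_paths k)" by (auto simp: dyadic_cyl_def)
    show "emeasure (density ?RP ?Z) X = emeasure ?RV X" if "X \<in> ?G" for X
    proof -
      from that obtain m x where "X = dyadic_cyl k T m x" by auto
      then show ?thesis using eq by (simp only:)
    qed
    show "sets (density ?RP ?Z) = sigma_sets (cadlag_paths k) ?G" "sets ?RV = sigma_sets (cadlag_paths k) ?G"
      unfolding sets_path_past_dyadic[OF T, symmetric] by (simp_all add: st)
    show "A \<subseteq> ?G" unfolding A_def by blast
    show "countable A" unfolding A_def by (intro countable_finite finite_imageI finite_PiE) auto
    show "emeasure (density ?RP ?Z) a \<noteq> \<infinity>" if "a \<in> A" for a
    proof -
      from that obtain x where x: "a = dyadic_cyl k T 0 x" by (auto simp: A_def)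
      show ?thesis unfolding x eq emeasure_restr_to_subalg[OF sub(2) dyadic_cyl_in_path_past[OF T]]
        by (simp add: V.emeasure_eq_measure)
    qed
    show "\<Union>A = cadlag_paths k"
    proof
      show "\<Union>A \<subseteq> cadlag_paths k" by (auto simp: A_def dyadic_cyl_def)
      show "cadlag_paths k \<subseteq> \<Union>A"
      proof
        fix \<omega> assume w: "\<omega> \<in> cadlag_paths k"
        define x where "x = (\<lambda>i\<in>{..1::nat}. \<omega> (real i * T))"
        have "x \<in> {..1} \<rightarrow>\<^sub>E {..<k}" using path_in_states[OF w] T by (auto simp: x_def)
        moreover have "\<omega> \<in> dyadic_cyl k T 0 x" using w by (auto simp: x_def dyadic_cyl_def)
        ultimately show "\<omega> \<in> \<Union>A" by (auto simp: A_def)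
      qed
    qed
  qed
qed

lemma gibbs_semigroup_stationary:
  assumes perron: "perron_triple V k lam u mu"
  shows "(\<Sum>j<k. gibbs_prob u mu j * exp_op (gibbs_gen k u) t f j) = (\<Sum>j<k. gibbs_prob u mu j * f j)"
proof -
  interpret finite_op k "gibbs_gen k u" "\<lambda>x y. gibbs_gen k u (indicator {y}) x"
    by (rule finite_op_gibbs_gen)
  let ?S = "\<lambda>t. \<Sum>j<k. gibbs_prob u mu j * exp_op (gibbs_gen k u) t f j"
  have "(?S has_real_derivative 0) (at s)" for s
  proof -
    have "(?S has_real_derivative (\<Sum>j<k. gibbs_prob u mu j * exp_op (gibbs_gen k u) s (gibbs_gen k u f) j)) (at s)"
      by (intro DERIV_sum DERIV_cmult exp_deriv) simp
    moreover have "(\<Sum>j<k. gibbs_prob u mu j * exp_op (gibbs_gen k u) s (gibbs_gen k u f) j) = 0"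
      using gibbs_prob_stationary[OF perron] by (simp add: exp_commute)
    ultimately show ?thesis by simp
  qed
  then have "?S t = ?S 0" using DERIV_isconst_all[of ?S t 0] by blast
  then show ?thesis by (simp add: exp_0)
qed

lemma gibbs_chain_marginal:
  assumes perron: "perron_triple V k lam u mu" and t: "0 \<le> t"
    and lawV: "chain_law k (gibbs_gen k u) (gibbs_prob u mu) PV"
  shows "has_bochner_integral PV (\<lambda>\<omega>. g (\<omega> t)) (\<Sum>y<k. g y * gibbs_prob u mu y)"
proof -
  have st: "(\<Sum>x<k. gibbs_prob u mu x * exp_op (gibbs_gen k u) t (indicator {y}) x) = gibbs_prob u mu y" if "y < k" for y
  proof -
    have "(\<Sum>x<k. gibbs_prob u mu x * indicator {y} x) = (\<Sum>x<k. if x = y then gibbs_prob u mu y else 0)"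
      by (intro sum.cong) (auto simp: indicator_def)
    then show ?thesis unfolding gibbs_semigroup_stationary[OF perron] using that by simp
  qed
  have "has_bochner_integral PV (\<lambda>\<omega>. 1 * (\<Prod>i<1. g (\<omega> (real (Suc i) * t))))
     (\<Sum>y<k. fwd k (\<lambda>y. gibbs_prob u mu y * 1)
        (\<lambda>i x y. exp_op (gibbs_gen k u) t (indicator {y}) x * g y) 1 y)"
    by (rule chain_path_integral[OF lawV t, where h = "\<lambda>_. 1" and w = "\<lambda>_ _ y. g y"])
  moreover have "fwd k (\<lambda>y. gibbs_prob u mu y * 1)
        (\<lambda>i x y. exp_op (gibbs_gen k u) t (indicator {y}) x * g y) 1 y = g y * gibbs_prob u mu y" if "y < k" for y
  proof -
    have "fwd k (\<lambda>y. gibbs_prob u mu y * 1)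
          (\<lambda>i x y. exp_op (gibbs_gen k u) t (indicator {y}) x * g y) 1 y
        = (\<Sum>x<k. gibbs_prob u mu x * exp_op (gibbs_gen k u) t (indicator {y}) x) * g y"
      by (simp add: sum_distrib_right mult.assoc)
    then show ?thesis unfolding st[OF that] by (simp only: mult.commute)
  qed
  ultimately show ?thesis by simp
qed

text \<open>The mean of the time integral is again obtained from Riemann sums, whose means do not depend on
the mesh because all one-time marginals equal \<open>gibbs_prob\<close>.\<close>

lemma gibbs_log_density_integral:
  assumes perron: "perron_triple V k lam u mu" and T: "0 \<le> T"
    and lawV: "chain_law k (gibbs_gen k u) (gibbs_prob u mu) PV"
  shows "has_bochner_integral PV (\<lambda>\<omega>. ln (path_density c u T \<omega>)) (T * (\<Sum>y<k. c y * gibbs_prob u mu y))"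
proof -
  have pos: "\<And>j. j < k \<Longrightarrow> 0 < u j" using perron by (auto simp: perron_triple_def)
  interpret prob_space PV using lawV by (simp add: chain_law_def)
  have sp: "space PV = cadlag_paths k" using lawV by (simp add: chain_law_def)
  have sub: "subalgebra PV (path_past k T)" by (rule chain_past_subalgebra[OF lawV])
  let ?I = "\<lambda>\<omega>. \<integral>s. indicator {0<..T} s * c (\<omega> s) \<partial>lborel"
  let ?R = "\<lambda>N \<omega>. \<Sum>j<2 ^ N. T / 2 ^ N * c (\<omega> (real (Suc j) * (T / 2 ^ N)))"
  let ?e = "\<lambda>g. \<Sum>y<k. g y * gibbs_prob u mu y"
  have m1: "?R N \<in> borel_measurable PV" for N
    by (rule measurable_from_subalg[OF sub riemann_sum_measurable[OF T]])
  have m2: "?I \<in> borel_measurable PV"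
    by (rule measurable_from_subalg[OF sub path_integral_measurable[OF T]])
  have lim: "AE \<omega> in PV. (\<lambda>N. ?R N \<omega>) \<longlonglongrightarrow> ?I \<omega>"
    using right_riemann_sums_tendsto[OF _ T] sp by (intro AE_I2) simp
  have bound: "AE \<omega> in PV. norm (?R N \<omega>) \<le> T * (\<Sum>i<k. \<bar>c i\<bar>)" for N
    using riemann_sum_abs_le[OF _ T] sp by (intro AE_I2) simp
  have int: "integrable PV ?I" and conv: "(\<lambda>N. \<integral>\<omega>. ?R N \<omega> \<partial>PV) \<longlonglongrightarrow> (\<integral>\<omega>. ?I \<omega> \<partial>PV)"
    using integrable_dominated_convergence[OF m2 m1 integrable_const lim bound]
      integral_dominated_convergence[OF m2 m1 integrable_const lim bound] by auto
  have "(\<integral>\<omega>. ?R N \<omega> \<partial>PV) = T * ?e c" for N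
  proof -
    have "has_bochner_integral PV (?R N) (\<Sum>j<(2::nat) ^ N. T / 2 ^ N * ?e c)"
      using T by (intro has_bochner_integral_sum has_bochner_integral_mult_right gibbs_chain_marginal[OF perron _ lawV]) simp
    then show ?thesis by (simp add: has_bochner_integral_integral_eq)
  qed
  then have "(\<integral>\<omega>. ?I \<omega> \<partial>PV) = T * ?e c" using LIMSEQ_unique[OF conv] by simp
  then have "has_bochner_integral PV ?I (T * ?e c)" using int by (simp add: has_bochner_integral_iff)
  then have "has_bochner_integral PV (\<lambda>\<omega>. ln (u (\<omega> T)) - ln (u (\<omega> 0)) + ?I \<omega>)
      (?e (\<lambda>y. ln (u y)) - ?e (\<lambda>y. ln (u y)) + T * ?e c)"
    using T by (intro has_bochner_integral_add has_bochner_integral_diff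
        gibbs_chain_marginal[OF perron _ lawV, where g = "\<lambda>y. ln (u y)"]) auto
  moreover have "ln (u (\<omega> T)) - ln (u (\<omega> 0)) + ?I \<omega> = ln (path_density c u T \<omega>)" if "\<omega> \<in> space PV" for \<omega>
  proof -
    have "0 < u (\<omega> T)" "0 < u (\<omega> 0)" using that T by (auto intro!: pos path_in_states[of \<omega> k] simp: sp)
    then show ?thesis unfolding path_density_def by (simp add: ln_mult ln_div)
  qed
  ultimately show ?thesis by (subst (asm) has_bochner_integral_cong[OF refl _ refl]) auto
qed

text \<open>By uniqueness of Radon-Nikodym derivatives the logarithmic density is \<open>ln (path_density c u T)\<close>
almost surely for the free law, hence for the Gibbs law. Its mean is exactly linear in \<open>T\<close>, so the averages
over \<open>[0, T]\<close> are constant for \<open>T > 0\<close>.\<close>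

lemma gibbs_path_entropy:
  assumes perron: "perron_triple V k lam u mu"
    and lawV: "chain_law k (gibbs_gen k u) (gibbs_prob u mu) PV"
    and law: "chain_law k (free_gen k) (gibbs_prob u mu) P"
  shows "has_path_entropy k PV P (lam - (\<Sum>j<k. real k * pot V k j * gibbs_prob u mu j))"
proof -
  define c where "c = (\<lambda>y. real k * pot V k y - lam)"
  define h where "h = lam - (\<Sum>j<k. real k * pot V k j * gibbs_prob u mu j)"
  have ec: "(\<Sum>y<k. c y * gibbs_prob u mu y) = - h"
    using gibbs_prob_sum(1)[OF perron]
    by (simp add: c_def h_def left_diff_distrib sum_subtractf flip: sum_distrib_left)
  have pos: "\<And>j. j < k \<Longrightarrow> 0 < u j" using perron by (auto simp: perron_triple_def)
  interpret P: prob_space P using law by (simp add: chain_law_def)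
  have sp: "space PV = cadlag_paths k" using lawV by (simp add: chain_law_def)
  have main: "absolutely_continuous (restr_to_subalg P (path_past k T)) (restr_to_subalg PV (path_past k T))
      \<and> has_bochner_integral PV (log_density k PV P T) (- T * h)" if T: "0 \<le> T" for T
  proof -
    let ?RP = "restr_to_subalg P (path_past k T)" and ?RV = "restr_to_subalg PV (path_past k T)"
    let ?Z = "\<lambda>\<omega>. ennreal (path_density c u T \<omega>)"
    have sub: "subalgebra P (path_past k T)" "subalgebra PV (path_past k T)"
      using chain_past_subalgebra law lawV by blast+
    have st: "sets ?RP = sets (path_past k T)" "sets ?RV = sets (path_past k T)"
      using sub by (simp_all add: sets_restr_to_subalg)
    have Zm: "?Z \<in> borel_measurable ?RP"
      using path_density_measurable[OF T, of c u k] unfolding measurable_cong_sets[OF st(1) refl] by measurable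
    interpret RP: prob_space ?RP by (rule prob_space_restr_to_subalg[OF sub(1) P.prob_space_axioms])
    have dens: "density ?RP ?Z = ?RV" by (rule gibbs_law_density[OF perron c_def law lawV T])
    have ac: "absolutely_continuous ?RP ?RV"
      unfolding dens[symmetric] by (rule absolutely_continuousI_density[OF Zm])
    have "AE \<omega> in ?RP. ?Z \<omega> = RN_deriv ?RP ?RV \<omega>"
      using Zm dens by (rule RP.RN_deriv_unique)
    then have "AE \<omega> in ?RV. ?Z \<omega> = RN_deriv ?RP ?RV \<omega>"
      using st by (intro absolutely_continuous_AE[OF _ ac]) auto
    then have "AE \<omega> in PV. ?Z \<omega> = RN_deriv ?RP ?RV \<omega>" by (rule AE_restr_to_subalg[OF sub(2)])
    then have ae: "AE \<omega> in PV. ln (path_density c u T \<omega>) = log_density k PV P T \<omega>"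
    proof (rule AE_mp, intro AE_I2 impI)
      fix \<omega> assume w: "\<omega> \<in> space PV" and e: "?Z \<omega> = RN_deriv ?RP ?RV \<omega>"
      have "0 \<le> path_density c u T \<omega>" using path_density_pos[where u = u, OF _ T pos] w sp by (auto intro: less_imp_le)
      then show "ln (path_density c u T \<omega>) = log_density k PV P T \<omega>"
        unfolding log_density_def e[symmetric] by simp
    qed
    have "RN_deriv ?RP ?RV \<in> borel_measurable (path_past k T)"
      using borel_measurable_RN_deriv[of ?RP ?RV] unfolding measurable_cong_sets[OF st(1) refl] .
    then have "log_density k PV P T \<in> borel_measurable (path_past k T)"
      unfolding log_density_def[abs_def] by measurable
    then have lm: "log_density k PV P T \<in> borel_measurable PV" by (rule measurable_from_subalg[OF sub(2)])
    have hb: "has_bochner_integral PV (\<lambda>\<omega>. ln (path_density c u T \<omega>)) (- T * h)"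
      using gibbs_log_density_integral[OF perron T lawV, of c] unfolding ec by simp
    have "has_bochner_integral PV (log_density k PV P T) (- T * h)"
      using has_bochner_integral_cong_AE[OF _ lm ae] hb has_bochner_integral_iff
        borel_measurable_has_bochner_integral by blast
    then show ?thesis using ac by blast
  qed
  have "\<forall>\<^sub>F T in at_top. h = 1 / T * entropy_upto k PV P T"
    using eventually_gt_at_top[of 0]
  proof eventually_elim
    case (elim T)
    have "(\<integral>\<omega>. log_density k PV P T \<omega> \<partial>PV) = - T * h"
      using main[of T] elim by (simp add: has_bochner_integral_integral_eq)
    then show ?case using elim by (simp add: entropy_upto_def)
  qed
  then have "((\<lambda>T. 1 / T * entropy_upto k PV P T) \<longlongrightarrow> h) at_top"
    by (rule Lim_transform_eventually[OF tendsto_const])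
  then show ?thesis
    unfolding has_path_entropy_def h_def using main by (auto simp: has_bochner_integral_iff)
qed

theorem mainTheorem3:
  fixes V :: "real \<Rightarrow> real"
    and lam :: "nat \<Rightarrow> real"
    and u mu :: "nat \<Rightarrow> nat \<Rightarrow> real"
    and PV P :: "nat \<Rightarrow> (real \<Rightarrow> nat) measure"
    and F :: "real \<Rightarrow> real \<times> real \<Rightarrow> real \<times> real"
  assumes V: "circle_C2 V"
    and perron: "\<And>k. k \<ge> 1 \<Longrightarrow> perron_triple V k (lam k) (u k) (mu k)"
    and PV: "\<And>k. k \<ge> 1 \<Longrightarrow>
               chain_law k (gibbs_gen k (u k)) (gibbs_prob (u k) (mu k)) (PV k)"
    and P: "\<And>k. k \<ge> 1 \<Longrightarrow>
               chain_law k (free_gen k) (gibbs_prob (u k) (mu k)) (P k)"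
    and F: "EL_flow V F"
  shows "(\<forall>k\<ge>1. has_path_entropy k (PV k) (P k)
              (lam k - (\<Sum>j<k. real k * pot V k j * gibbs_prob (u k) (mu k) j)))
       \<and> crit_value V F = (SUP x\<in>{0..<1}. V x)
       \<and> (\<forall>x0\<in>{0..<1}. (\<forall>x\<in>{0..<1}. x \<noteq> x0 \<longrightarrow> V x < V x0) \<longrightarrow>
            (\<forall>nu. is_mather_measure V F nu \<longleftrightarrow> nu = return circle_alg x0)
          \<and> (\<lambda>k. path_entropy k (PV k) (P k) / real k) \<longlonglongrightarrow> V x0 - crit_value V F
          \<and> (\<lambda>k. \<Sum>j<k. pot V k j * gibbs_prob (u k) (mu k) j) \<longlonglongrightarrow> V x0
          \<and> (\<lambda>k. lam k / real k) \<longlonglongrightarrow> crit_value V F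
          \<and> V x0 - crit_value V F = 0)"
proof -
  have entropy: "has_path_entropy k (PV k) (P k)
      (lam k - (\<Sum>j<k. real k * pot V k j * gibbs_prob (u k) (mu k) j))" if "k \<ge> 1" for k
    by (rule gibbs_path_entropy[OF perron[OF that] PV[OF that] P[OF that]])
  have crit: "crit_value V F = V x0" if "x0 \<in> {0..<1}" "\<And>x. V x \<le> V x0" for x0
    using min_action_eq[OF V F that] by (simp add: crit_value_def)
  have sup: "crit_value V F = (SUP x\<in>{0..<1}. V x)"
  proof -
    obtain x0 where x0: "x0 \<in> {0..<1}" "\<And>x. V x \<le> V x0" using circle_C2_attains_max[OF V] by blast
    have "(SUP x\<in>{0..<1}. V x) = V x0" using x0 by (intro cSup_eq_maximum) auto
    then show ?thesis using crit[OF x0] by simp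
  qed
  have unique: "(\<forall>nu. is_mather_measure V F nu \<longleftrightarrow> nu = return circle_alg x0)
          \<and> (\<lambda>k. path_entropy k (PV k) (P k) / real k) \<longlonglongrightarrow> V x0 - crit_value V F
          \<and> (\<lambda>k. \<Sum>j<k. pot V k j * gibbs_prob (u k) (mu k) j) \<longlonglongrightarrow> V x0
          \<and> (\<lambda>k. lam k / real k) \<longlonglongrightarrow> crit_value V F
          \<and> V x0 - crit_value V F = 0"
    if x0: "x0 \<in> {0..<1}" and uniq: "\<forall>x\<in>{0..<1}. x \<noteq> x0 \<longrightarrow> V x < V x0" for x0
  proof -
    have max: "V x \<le> V x0" for x
      using uniq[rule_format, of "frac x"] frac_lt_1[of x] frac_ge_0[of x] circle_C2_frac[OF V, of x]
      by (cases "frac x = x0") auto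
    have cv: "crit_value V F = V x0" by (rule crit[OF x0 max])
    have cont: "isCont V x0"
      using V by (auto simp: circle_C2_def intro!: differentiable_imp_continuous_within)
    have l: "(\<lambda>k. lam k / real k) \<longlonglongrightarrow> V x0"
      using perron cont x0 max by (rule perron_value_tendsto)
    have a: "(\<lambda>k. \<Sum>j<k. pot V k j * gibbs_prob (u k) (mu k) j) \<longlonglongrightarrow> V x0"
      using perron l max by (rule gibbs_average_tendsto)
    have "\<forall>\<^sub>F k in sequentially. lam k / real k - (\<Sum>j<k. pot V k j * gibbs_prob (u k) (mu k) j)
        = path_entropy k (PV k) (P k) / real k"
    proof (rule eventually_sequentiallyI)
      fix k :: nat assume k: "1 \<le> k"
      have "(\<Sum>j<k. real k * pot V k j * gibbs_prob (u k) (mu k) j)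
          = real k * (\<Sum>j<k. pot V k j * gibbs_prob (u k) (mu k) j)"
        by (simp add: sum_distrib_left mult.assoc)
      then show "lam k / real k - (\<Sum>j<k. pot V k j * gibbs_prob (u k) (mu k) j)
          = path_entropy k (PV k) (P k) / real k"
        using k unfolding has_path_entropy_imp_eq[OF entropy[OF k]] by (simp add: diff_divide_distrib)
    qed
    then have "(\<lambda>k. path_entropy k (PV k) (P k) / real k) \<longlonglongrightarrow> V x0 - V x0"
      by (rule Lim_transform_eventually[OF tendsto_diff[OF l a]])
    then show ?thesis
      using mather_measure_unique[OF V F x0 max] uniq l a by (simp add: cv)
  qed
  show ?thesis using entropy sup unique by blast
qed

end
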